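(* Let $R$ be a commutative ring with $1$, let $A$ be a commutative $R$-algebra, and let $(A,\{\cdot,\cdot\})$ be a Poisson algebra over $R$. Let $D_A$ be the $A$-module of Kähler differentials of $A$ over $R$, let $\pi\colon D_A\otimes_A D_A\to A$ be the $A$-bilinear alternating form given by $\pi(a\,du\otimes b\,dv)=ab\{u,v\}$, and let $$\pi^{\sharp}\colon D_A\to \mathrm{Hom}_A(D_A,A)=\mathrm{Der}(A)$$ be its adjoint, so that $\pi^\sharp(a\,du)=a\{u,-\}$. For $a,b,u,v\in A$ let $$[a\,du,\,b\,dv]=a\{u,b\}\,dv+b\{a,v\}\,du+ab\,d\{u,v\}\in D_A .$$ Then $(\pi^{\sharp},[\cdot,\cdot])$ together with the $A$-module structure endows $D_A$ with a structure of an $(R,A)$-Lie algebra (in particular, the bracket is well defined) in such a way that $\pi^\sharp\colon D_A\to\mathrm{Der}(A)$ is a morphism of $(R,A)$-Lie algebras.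
   Context: A Poisson algebra structure on a commutative $R$-algebra $A$ is a Lie bracket $\{\cdot,\cdot\}\colon A\otimes_R A\to A$ over $R$ with $\{ab,c\}=a\{b,c\}+\{a,c\}b$ for all $a,b,c\in A$. $D_A$ is the $A$-module generated by symbols $da$ ($a\in A$), with $d$ $R$-linear, subject to $d(bc)=(db)c+b\,dc$ and $dr=0$ for $r\in R$; it satisfies $\mathrm{Hom}_A(D_A,A)\cong\mathrm{Der}(A)$ naturally, where $\mathrm{Der}(A)$ is the $A$-module and $R$-Lie algebra of $R$-linear derivations of $A$. An $(R,A)$-Lie algebra is a Lie algebra $L$ over $R$ that is also a left $A$-module, together with a morphism of $R$-Lie algebras $L\to\mathrm{Der}(A)$, $\alpha\mapsto(a\mapsto\alpha(a))$ (an action of $L$ on $A$), such that for $\alpha,\beta\in L$ and $a,b\in A$: $(a\alpha)(b)=a(\alpha(b))$ and $[\alpha,a\beta]=a[\alpha,\beta]+\alpha(a)\beta$. $\mathrm{Der}(A)$ is an $(R,A)$-Lie algebra with the identity as action. A morphism of $(R,A)$-Lie algebras is an $A$-linear morphism of $R$-Lie algebras compatible with the actions on $A$. *)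

theory Defs
  imports "HOL.Hull" "HOL-Algebra.Module" "HOL-Algebra.AbelCoset"
begin

text \<open>
  In all module records below that are not rings, the ring fields \<open>mult\<close> and \<open>one\<close> carry no
  information and are set to \<open>undefined\<close>. Sets of maps that serve as carriers consist of
  extensional functions (value \<open>undefined\<close> off the domain), so that equality of maps is equality
  in HOL.
\<close>

section \<open>Linear maps, restriction of scalars, quotient modules, free modules\<close>

definition linear_maps ::
    "('s, 'k) ring_scheme \<Rightarrow> ('s, 'l, 'm) module_scheme \<Rightarrow> ('s, 'p, 'n) module_scheme \<Rightarrow> ('l \<Rightarrow> 'p) set"
  where "linear_maps S M N = {f \<in> carrier M \<rightarrow> carrier N.
    (\<forall>x\<in>carrier M. \<forall>y\<in>carrier M. f (x \<oplus>\<^bsub>M\<^esub> y) = f x \<oplus>\<^bsub>N\<^esub> f y) \<and>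
    (\<forall>s\<in>carrier S. \<forall>x\<in>carrier M. f (s \<odot>\<^bsub>M\<^esub> x) = s \<odot>\<^bsub>N\<^esub> f x)}"

text \<open>The \<open>R\<close>-module underlying a module \<open>L\<close> over the \<open>R\<close>-algebra \<open>A\<close>.\<close>

definition restrict_scalars ::
    "('r, 'k) ring_scheme \<Rightarrow> ('r, 'a, 'm) module_scheme \<Rightarrow> ('a, 'l, 'n) module_scheme \<Rightarrow> ('r, 'l) module"
  where "restrict_scalars R A L = \<lparr>carrier = carrier L, mult = undefined, one = undefined,
    zero = \<zero>\<^bsub>L\<^esub>, add = add L, smult = (\<lambda>r x. (r \<odot>\<^bsub>A\<^esub> \<one>\<^bsub>A\<^esub>) \<odot>\<^bsub>L\<^esub> x)\<rparr>"

text \<open>A ring as a module over itself.\<close>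

definition self_module :: "('a, 'm) ring_scheme \<Rightarrow> ('a, 'a) module"
  where "self_module A = \<lparr>carrier = carrier A, mult = mult A, one = \<one>\<^bsub>A\<^esub>,
    zero = \<zero>\<^bsub>A\<^esub>, add = add A, smult = mult A\<rparr>"

definition quotient_module :: "('s, 'l, 'm) module_scheme \<Rightarrow> 'l set \<Rightarrow> ('s, 'l set) module"
  where "quotient_module M N = \<lparr>carrier = a_rcosets\<^bsub>M\<^esub> N, mult = undefined, one = undefined,
    zero = N, add = set_add M, smult = (\<lambda>s X. \<Union>x\<in>X. N +>\<^bsub>M\<^esub> (s \<odot>\<^bsub>M\<^esub> x))\<rparr>"

text \<open>The free \<open>A\<close>-module on the set \<open>X\<close>: finitely supported functions, here extended by zero.\<close>

definition free_module :: "('a, 'm) ring_scheme \<Rightarrow> 'x set \<Rightarrow> ('a, 'x \<Rightarrow> 'a) module"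
  where "free_module A X = \<lparr>
    carrier = {f. (\<forall>x. f x \<in> carrier A) \<and> (\<forall>x. x \<notin> X \<longrightarrow> f x = \<zero>\<^bsub>A\<^esub>) \<and> finite {x. f x \<noteq> \<zero>\<^bsub>A\<^esub>}},
    mult = undefined, one = undefined,
    zero = (\<lambda>x. \<zero>\<^bsub>A\<^esub>), add = (\<lambda>f g x. f x \<oplus>\<^bsub>A\<^esub> g x), smult = (\<lambda>a f x. a \<otimes>\<^bsub>A\<^esub> f x)\<rparr>"

definition free_gen :: "('a, 'm) ring_scheme \<Rightarrow> 'x \<Rightarrow> 'x \<Rightarrow> 'a"
  where "free_gen A x = (\<lambda>y. if y = x then \<one>\<^bsub>A\<^esub> else \<zero>\<^bsub>A\<^esub>)"


section \<open>Lie algebras over a commutative ring\<close>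

locale lie_algebra = module R L
  for R :: "('r, 'k) ring_scheme" (structure) and L :: "('r, 'l, 'm) module_scheme" (structure) +
  fixes bracket :: "'l \<Rightarrow> 'l \<Rightarrow> 'l"
  assumes bracket_closed:
      "\<lbrakk>x \<in> carrier L; y \<in> carrier L\<rbrakk> \<Longrightarrow> bracket x y \<in> carrier L"
    and bracket_add_left: "\<lbrakk>x \<in> carrier L; y \<in> carrier L; z \<in> carrier L\<rbrakk> \<Longrightarrow>
      bracket (x \<oplus>\<^bsub>L\<^esub> y) z = bracket x z \<oplus>\<^bsub>L\<^esub> bracket y z"
    and bracket_add_right: "\<lbrakk>x \<in> carrier L; y \<in> carrier L; z \<in> carrier L\<rbrakk> \<Longrightarrow>
      bracket x (y \<oplus>\<^bsub>L\<^esub> z) = bracket x y \<oplus>\<^bsub>L\<^esub> bracket x z"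
    and bracket_smult_left: "\<lbrakk>r \<in> carrier R; x \<in> carrier L; y \<in> carrier L\<rbrakk> \<Longrightarrow>
      bracket (r \<odot>\<^bsub>L\<^esub> x) y = r \<odot>\<^bsub>L\<^esub> bracket x y"
    and bracket_smult_right: "\<lbrakk>r \<in> carrier R; x \<in> carrier L; y \<in> carrier L\<rbrakk> \<Longrightarrow>
      bracket x (r \<odot>\<^bsub>L\<^esub> y) = r \<odot>\<^bsub>L\<^esub> bracket x y"
    and bracket_self: "x \<in> carrier L \<Longrightarrow> bracket x x = \<zero>\<^bsub>L\<^esub>"
    and jacobi: "\<lbrakk>x \<in> carrier L; y \<in> carrier L; z \<in> carrier L\<rbrakk> \<Longrightarrow>
      bracket x (bracket y z) \<oplus>\<^bsub>L\<^esub> bracket y (bracket z x) \<oplus>\<^bsub>L\<^esub> bracket z (bracket x y) = \<zero>\<^bsub>L\<^esub>"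

locale lie_algebra_hom = dom: lie_algebra R L brL + cod: lie_algebra R M brM
  for R :: "('r, 'k) ring_scheme"
    and L :: "('r, 'l, 'm) module_scheme" and brL :: "'l \<Rightarrow> 'l \<Rightarrow> 'l"
    and M :: "('r, 'p, 'n) module_scheme" and brM :: "'p \<Rightarrow> 'p \<Rightarrow> 'p" +
  fixes f :: "'l \<Rightarrow> 'p"
  assumes linear: "f \<in> linear_maps R L M"
    and map_bracket: "\<lbrakk>x \<in> carrier L; y \<in> carrier L\<rbrakk> \<Longrightarrow> f (brL x y) = brM (f x) (f y)"


section \<open>Derivations\<close>

definition derivations :: "('r, 'k) ring_scheme \<Rightarrow> ('r, 'a, 'm) module_scheme \<Rightarrow> ('a \<Rightarrow> 'a) set"
  where "derivations R A = {f \<in> carrier A \<rightarrow>\<^sub>E carrier A. f \<in> linear_maps R A A \<and>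
    (\<forall>a\<in>carrier A. \<forall>b\<in>carrier A. f (a \<otimes>\<^bsub>A\<^esub> b) = f a \<otimes>\<^bsub>A\<^esub> b \<oplus>\<^bsub>A\<^esub> a \<otimes>\<^bsub>A\<^esub> f b)}"

definition Der :: "('r, 'k) ring_scheme \<Rightarrow> ('r, 'a, 'm) module_scheme \<Rightarrow> ('a, 'a \<Rightarrow> 'a) module"
  where "Der R A = \<lparr>carrier = derivations R A, mult = undefined, one = undefined,
    zero = (\<lambda>x\<in>carrier A. \<zero>\<^bsub>A\<^esub>),
    add = (\<lambda>f g. \<lambda>x\<in>carrier A. f x \<oplus>\<^bsub>A\<^esub> g x),
    smult = (\<lambda>a f. \<lambda>x\<in>carrier A. a \<otimes>\<^bsub>A\<^esub> f x)\<rparr>"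

definition commutator :: "('r, 'a, 'm) module_scheme \<Rightarrow> ('a \<Rightarrow> 'a) \<Rightarrow> ('a \<Rightarrow> 'a) \<Rightarrow> 'a \<Rightarrow> 'a"
  where "commutator A f g = (\<lambda>x\<in>carrier A. f (g x) \<ominus>\<^bsub>A\<^esub> g (f x))"


section \<open>Lie algebras over a pair \<open>(R, A)\<close>\<close>

text \<open>
  The structure of \<open>R\<close>-module on \<open>L\<close> is the one induced by its structure of \<open>A\<close>-module. The
  action is a map from \<open>L\<close> to \<open>Der(A)\<close>, so \<open>act \<alpha> a\<close> is what is usually written \<open>\<alpha>(a)\<close>.
\<close>

locale ra_lie_algebra =
  alg: algebra R A +
  mod: module A L +
  action: lie_algebra_hom R "restrict_scalars R A L" bracket
    "restrict_scalars R A (Der R A)" "commutator A" act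
  for R :: "('r, 'k) ring_scheme" and A :: "('r, 'a, 'm) module_scheme"
    and L :: "('a, 'l, 'n) module_scheme"
    and bracket :: "'l \<Rightarrow> 'l \<Rightarrow> 'l" and act :: "'l \<Rightarrow> 'a \<Rightarrow> 'a" +
  assumes act_smult: "\<lbrakk>a \<in> carrier A; \<alpha> \<in> carrier L; b \<in> carrier A\<rbrakk> \<Longrightarrow>
      act (a \<odot>\<^bsub>L\<^esub> \<alpha>) b = a \<otimes>\<^bsub>A\<^esub> act \<alpha> b"
    and bracket_smult: "\<lbrakk>\<alpha> \<in> carrier L; a \<in> carrier A; \<beta> \<in> carrier L\<rbrakk> \<Longrightarrow>
      bracket \<alpha> (a \<odot>\<^bsub>L\<^esub> \<beta>) = a \<odot>\<^bsub>L\<^esub> bracket \<alpha> \<beta> \<oplus>\<^bsub>L\<^esub> act \<alpha> a \<odot>\<^bsub>L\<^esub> \<beta>"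

locale ra_lie_algebra_hom =
  dom: ra_lie_algebra R A L brL actL +
  cod: ra_lie_algebra R A M brM actM
  for R :: "('r, 'k) ring_scheme" and A :: "('r, 'a, 'm) module_scheme"
    and L :: "('a, 'l, 'n) module_scheme"
    and brL :: "'l \<Rightarrow> 'l \<Rightarrow> 'l" and actL :: "'l \<Rightarrow> 'a \<Rightarrow> 'a"
    and M :: "('a, 'p, 'q) module_scheme"
    and brM :: "'p \<Rightarrow> 'p \<Rightarrow> 'p" and actM :: "'p \<Rightarrow> 'a \<Rightarrow> 'a" +
  fixes f :: "'l \<Rightarrow> 'p"
  assumes A_linear: "f \<in> linear_maps A L M"
    and lie_hom: "lie_algebra_hom R (restrict_scalars R A L) brL (restrict_scalars R A M) brM f"
    and act_compatible: "\<lbrakk>\<alpha> \<in> carrier L; a \<in> carrier A\<rbrakk> \<Longrightarrow> actM (f \<alpha>) a = actL \<alpha> a"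


section \<open>Poisson algebras\<close>

locale poisson_algebra = alg: algebra R A + lie: lie_algebra R A poisson
  for R :: "('r, 'k) ring_scheme" and A :: "('r, 'a, 'm) module_scheme"
    and poisson :: "'a \<Rightarrow> 'a \<Rightarrow> 'a" +
  assumes poisson_mult: "\<lbrakk>a \<in> carrier A; b \<in> carrier A; c \<in> carrier A\<rbrakk> \<Longrightarrow>
    poisson (a \<otimes>\<^bsub>A\<^esub> b) c = a \<otimes>\<^bsub>A\<^esub> poisson b c \<oplus>\<^bsub>A\<^esub> poisson a c \<otimes>\<^bsub>A\<^esub> b"


section \<open>Kaehler differentials\<close>

text \<open>
  The module of Kaehler differentials is the free \<open>A\<close>-module on symbols \<open>e a\<close>, one for each
  \<open>a\<close> in \<open>A\<close>, modulo the submodule generated by the following relations; \<open>d a\<close> is the class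
  of \<open>e a\<close>.
\<close>

definition kaehler_relations ::
    "('r, 'k) ring_scheme \<Rightarrow> ('r, 'a, 'm) module_scheme \<Rightarrow> ('a \<Rightarrow> 'a) set"
  where "kaehler_relations R A = (let F = free_module A (carrier A); e = free_gen A in
    {e (b \<oplus>\<^bsub>A\<^esub> c) \<ominus>\<^bsub>F\<^esub> (e b \<oplus>\<^bsub>F\<^esub> e c) | b c. b \<in> carrier A \<and> c \<in> carrier A} \<union>
    {e (r \<odot>\<^bsub>A\<^esub> b) \<ominus>\<^bsub>F\<^esub> (r \<odot>\<^bsub>A\<^esub> \<one>\<^bsub>A\<^esub>) \<odot>\<^bsub>F\<^esub> e b | r b. r \<in> carrier R \<and> b \<in> carrier A} \<union>
    {e (b \<otimes>\<^bsub>A\<^esub> c) \<ominus>\<^bsub>F\<^esub> (c \<odot>\<^bsub>F\<^esub> e b \<oplus>\<^bsub>F\<^esub> b \<odot>\<^bsub>F\<^esub> e c) | b c. b \<in> carrier A \<and> c \<in> carrier A} \<union>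
    {e (r \<odot>\<^bsub>A\<^esub> \<one>\<^bsub>A\<^esub>) | r. r \<in> carrier R})"

definition kaehler_submodule ::
    "('r, 'k) ring_scheme \<Rightarrow> ('r, 'a, 'm) module_scheme \<Rightarrow> ('a \<Rightarrow> 'a) set"
  where "kaehler_submodule R A =
    (\<lambda>N. submodule N A (free_module A (carrier A))) hull kaehler_relations R A"

definition kaehler ::
    "('r, 'k) ring_scheme \<Rightarrow> ('r, 'a, 'm) module_scheme \<Rightarrow> ('a, ('a \<Rightarrow> 'a) set) module"
  where "kaehler R A = quotient_module (free_module A (carrier A)) (kaehler_submodule R A)"

definition kaehler_d ::
    "('r, 'k) ring_scheme \<Rightarrow> ('r, 'a, 'm) module_scheme \<Rightarrow> 'a \<Rightarrow> ('a \<Rightarrow> 'a) set"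
  where "kaehler_d R A a = kaehler_submodule R A +>\<^bsub>free_module A (carrier A)\<^esub> free_gen A a"


section \<open>The form, its adjoint, and the bracket on Kaehler differentials\<close>

text \<open>
  Maps out of a tensor square are rendered as extensional curried bilinear maps.
\<close>

definition kaehler_poisson_form ::
    "('r, 'k) ring_scheme \<Rightarrow> ('r, 'a, 'm) module_scheme \<Rightarrow> ('a \<Rightarrow> 'a \<Rightarrow> 'a) \<Rightarrow>
     (('a \<Rightarrow> 'a) set \<Rightarrow> ('a \<Rightarrow> 'a) set \<Rightarrow> 'a) \<Rightarrow> bool"
  where "kaehler_poisson_form R A P form \<longleftrightarrow> (let D = kaehler R A; d = kaehler_d R A in
    form \<in> carrier D \<rightarrow>\<^sub>E (carrier D \<rightarrow>\<^sub>E carrier A) \<and>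
    (\<forall>x\<in>carrier D. form x \<in> linear_maps A D (self_module A)) \<and>
    (\<forall>y\<in>carrier D. (\<lambda>x. form x y) \<in> linear_maps A D (self_module A)) \<and>
    (\<forall>x\<in>carrier D. form x x = \<zero>\<^bsub>A\<^esub>) \<and>
    (\<forall>a\<in>carrier A. \<forall>u\<in>carrier A. \<forall>b\<in>carrier A. \<forall>v\<in>carrier A.
      form (a \<odot>\<^bsub>D\<^esub> d u) (b \<odot>\<^bsub>D\<^esub> d v) = a \<otimes>\<^bsub>A\<^esub> b \<otimes>\<^bsub>A\<^esub> P u v))"

text \<open>
  The identification of \<open>Hom\<^sub>A(D, A)\<close> with \<open>Der(A)\<close> sends a linear form \<open>\<phi>\<close> on \<open>D\<close> to
  \<open>\<phi> \<circ> d\<close>.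
\<close>

definition der_of_hom ::
    "('r, 'k) ring_scheme \<Rightarrow> ('r, 'a, 'm) module_scheme \<Rightarrow> (('a \<Rightarrow> 'a) set \<Rightarrow> 'a) \<Rightarrow> 'a \<Rightarrow> 'a"
  where "der_of_hom R A \<phi> = (\<lambda>a\<in>carrier A. \<phi> (kaehler_d R A a))"

text \<open>Since \<open>form\<close> is curried, its adjoint with values in \<open>Hom\<^sub>A(D, A)\<close> is \<open>x \<mapsto> form x\<close>.\<close>

definition sharp ::
    "('r, 'k) ring_scheme \<Rightarrow> ('r, 'a, 'm) module_scheme \<Rightarrow>
     (('a \<Rightarrow> 'a) set \<Rightarrow> ('a \<Rightarrow> 'a) set \<Rightarrow> 'a) \<Rightarrow> ('a \<Rightarrow> 'a) set \<Rightarrow> 'a \<Rightarrow> 'a"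
  where "sharp R A form x = der_of_hom R A (form x)"

definition kaehler_bracket ::
    "('r, 'k) ring_scheme \<Rightarrow> ('r, 'a, 'm) module_scheme \<Rightarrow> ('a \<Rightarrow> 'a \<Rightarrow> 'a) \<Rightarrow>
     (('a \<Rightarrow> 'a) set \<Rightarrow> ('a \<Rightarrow> 'a) set \<Rightarrow> ('a \<Rightarrow> 'a) set) \<Rightarrow> bool"
  where "kaehler_bracket R A P br \<longleftrightarrow>
    (let D = kaehler R A; D\<^sub>R = restrict_scalars R A D; d = kaehler_d R A in
    br \<in> carrier D \<rightarrow>\<^sub>E (carrier D \<rightarrow>\<^sub>E carrier D) \<and>
    (\<forall>x\<in>carrier D. br x \<in> linear_maps R D\<^sub>R D\<^sub>R) \<and>
    (\<forall>y\<in>carrier D. (\<lambda>x. br x y) \<in> linear_maps R D\<^sub>R D\<^sub>R) \<and>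
    (\<forall>a\<in>carrier A. \<forall>u\<in>carrier A. \<forall>b\<in>carrier A. \<forall>v\<in>carrier A.
      br (a \<odot>\<^bsub>D\<^esub> d u) (b \<odot>\<^bsub>D\<^esub> d v) =
        (a \<otimes>\<^bsub>A\<^esub> P u b) \<odot>\<^bsub>D\<^esub> d v \<oplus>\<^bsub>D\<^esub> (b \<otimes>\<^bsub>A\<^esub> P a v) \<odot>\<^bsub>D\<^esub> d u \<oplus>\<^bsub>D\<^esub> (a \<otimes>\<^bsub>A\<^esub> b) \<odot>\<^bsub>D\<^esub> d (P u v)))"

end

theory Submission
  imports Defs
begin

text \<open>
  The difficulty is that the formula for \<open>[a du, b dv]\<close> does not visibly respect the relations of
  \<open>D\<close>, in either argument; once the bracket exists, all its laws follow from computations on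
  generators.

  In the second argument, the formula says that \<open>[a du, -]\<close> behaves like a Lie derivative
  along the derivation \<open>\<delta> = a{u,-}\<close> of \<open>A\<close>: it sends \<open>b y\<close> to \<open>b [a du, y] + \<delta>(b) y\<close>. Maps of this
  kind are no harder to define on \<open>D\<close> than linear ones. On the free module a first-order operator is
  given by any choice of values on the basis, and the elements \<open>f\<close> of the relation module at which
  the operator vanishes form a submodule, because the correction term involves only the class of
  \<open>f\<close>, which is zero. So it is enough to check the defining relations (\<open>twisted_extension\<close>). With
  \<open>\<delta> = 0\<close> this is the universal property of \<open>D\<close>, which gives the functionals \<open>\<pi>(du, -)\<close>.

  In the first argument no further relation has to be checked: the family \<open>[a du, -]\<close> is
  antisymmetric on generators, so the value at \<open>(\<Sum>\<^sub>i a\<^sub>i du\<^sub>i, b dv)\<close> equals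
  \<open>- [b dv, \<Sum>\<^sub>i a\<^sub>i du\<^sub>i]\<close>, which depends only on the element \<open>\<Sum>\<^sub>i a\<^sub>i du\<^sub>i\<close> of \<open>D\<close>
  (\<open>biadditive_extension\<close>). The same argument yields the form \<open>\<pi>\<close>. Uniqueness is clear since the
  elements \<open>a du\<close> generate \<open>D\<close> additively.

  The rule \<open>[x, c y] = c [x, y] + \<pi>\<^sup>\<sharp>(x)(c) y\<close> and the identity \<open>\<pi>\<^sup>\<sharp>[x, y] = [\<pi>\<^sup>\<sharp> x, \<pi>\<^sup>\<sharp> y]\<close> are
  equalities of biadditive expressions, hence can be checked on elements \<open>a du\<close>; for the second
  one this is the Jacobi identity of the Poisson bracket. Together they make the Jacobiator of \<open>D\<close>
  linear over \<open>A\<close> in its last argument, and by cyclic symmetry in each argument. So it vanishes as soon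
  as it vanishes on exact differentials, where \<open>[du, dv] = d{u, v}\<close> turns it into the differential
  of the Jacobiator of \<open>A\<close> (\<open>br_jacobi\<close>).
\<close>

section \<open>Quotient modules and free modules\<close>

lemma abelian_group_hom_of_additive:
  assumes "abelian_group G" and "abelian_group H"
    and "\<And>x. x \<in> carrier G \<Longrightarrow> h x \<in> carrier H"
    and "\<And>x y. \<lbrakk>x \<in> carrier G; y \<in> carrier G\<rbrakk> \<Longrightarrow> h (x \<oplus>\<^bsub>G\<^esub> y) = h x \<oplus>\<^bsub>H\<^esub> h y"
  shows "abelian_group_hom G H h"
  using assms
  by (intro abelian_group_homI group_hom.intro group_hom_axioms.intro homI
      abelian_group.a_group) simp_all

lemma (in module) submodule_abelian_subgroup:
  assumes "submodule N R M"
  shows "abelian_subgroup N M"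
proof (rule abelian_subgroupI3)
  show "additive_subgroup N M"
    by (rule additive_subgroup.intro) (rule submodule.axioms(1)[OF assms])
qed (rule M.abelian_group_axioms)

text \<open>
  Scalar multiplication on the quotient is a union over all representatives of the coset; the point
  is that all the cosets in that union coincide.
\<close>

lemma (in module) quotient_smult:
  assumes N: "submodule N R M" and s: "s \<in> carrier R" and x: "x \<in> carrier M"
  shows "s \<odot>\<^bsub>quotient_module M N\<^esub> (N +>\<^bsub>M\<^esub> x) = N +>\<^bsub>M\<^esub> (s \<odot>\<^bsub>M\<^esub> x)"
proof -
  interpret abelian_subgroup N M by (rule submodule_abelian_subgroup[OF N])
  have "N +>\<^bsub>M\<^esub> (s \<odot>\<^bsub>M\<^esub> y) = N +>\<^bsub>M\<^esub> (s \<odot>\<^bsub>M\<^esub> x)" if y: "y \<in> N +>\<^bsub>M\<^esub> x" for y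
  proof -
    have yc: "y \<in> carrier M" using y x a_elemrcos_carrier by blast
    have "y \<ominus>\<^bsub>M\<^esub> x \<in> N"
      using y yc x a_rcos_module[of x y] by (simp add: M.minus_eq)
    then have "s \<odot>\<^bsub>M\<^esub> (y \<ominus>\<^bsub>M\<^esub> x) \<in> N" by (rule submodule.smult_closed[OF N s])
    then have "s \<odot>\<^bsub>M\<^esub> y \<oplus>\<^bsub>M\<^esub> \<ominus>\<^bsub>M\<^esub> (s \<odot>\<^bsub>M\<^esub> x) \<in> N"
      using s x yc by (simp add: M.minus_eq smult_r_distr smult_r_minus)
    then have "s \<odot>\<^bsub>M\<^esub> y \<in> N +>\<^bsub>M\<^esub> (s \<odot>\<^bsub>M\<^esub> x)"
      using a_rcos_module[of "s \<odot>\<^bsub>M\<^esub> x" "s \<odot>\<^bsub>M\<^esub> y"] s x yc by simp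
    then show ?thesis
      by (rule a_repr_independence'[symmetric]) (simp add: s x)
  qed
  moreover have "x \<in> N +>\<^bsub>M\<^esub> x" by (rule a_rcos_self[OF x])
  ultimately have "(\<Union>y\<in>N +>\<^bsub>M\<^esub> x. N +>\<^bsub>M\<^esub> (s \<odot>\<^bsub>M\<^esub> y)) = N +>\<^bsub>M\<^esub> (s \<odot>\<^bsub>M\<^esub> x)"
    by blast
  then show ?thesis by (simp add: quotient_module_def)
qed

lemma (in module) quotient_add:
  assumes N: "submodule N R M" and x: "x \<in> carrier M" and y: "y \<in> carrier M"
  shows "(N +>\<^bsub>M\<^esub> x) \<oplus>\<^bsub>quotient_module M N\<^esub> (N +>\<^bsub>M\<^esub> y) = N +>\<^bsub>M\<^esub> (x \<oplus>\<^bsub>M\<^esub> y)"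
  using abelian_subgroup.a_rcos_sum[OF submodule_abelian_subgroup[OF N] x y]
  by (simp add: quotient_module_def)

lemma quotient_carrier: "carrier (quotient_module M N) = (\<lambda>x. N +>\<^bsub>M\<^esub> x) ` carrier M"
  by (auto simp: quotient_module_def A_RCOSETS_def')

lemma (in module) quotient_module_is_module:
  assumes N: "submodule N R M"
  shows "module R (quotient_module M N)"
proof (rule moduleI)
  interpret abelian_subgroup N M by (rule submodule_abelian_subgroup[OF N])
  let ?Q = "quotient_module M N"
  have zero: "\<zero>\<^bsub>?Q\<^esub> = N +>\<^bsub>M\<^esub> \<zero>\<^bsub>M\<^esub>"
    using a_subset by (simp add: quotient_module_def)
  show "abelian_group ?Q"
  proof (rule abelian_groupI)
    fix X assume "X \<in> carrier ?Q"
    then obtain x where x: "x \<in> carrier M" and X: "X = N +>\<^bsub>M\<^esub> x"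
      by (auto simp: quotient_carrier)
    show "\<exists>Y\<in>carrier ?Q. Y \<oplus>\<^bsub>?Q\<^esub> X = \<zero>\<^bsub>?Q\<^esub>"
      using x unfolding X zero quotient_carrier
      by (intro bexI[of _ "N +>\<^bsub>M\<^esub> (\<ominus>\<^bsub>M\<^esub> x)"]) (simp_all add: quotient_add[OF N] M.l_neg)
  qed (auto simp: quotient_carrier quotient_add[OF N] zero M.a_ac)
  show "cring R" by (rule R.is_cring)
qed (auto simp: quotient_carrier quotient_smult[OF N] quotient_add[OF N]
      smult_l_distr smult_r_distr smult_assoc1)

lemma (in cring) free_module_is_module: "module R (free_module R X)"
proof (rule moduleI)
  let ?F = "free_module R X"
  show "cring R" by (rule is_cring)
  show "abelian_group ?F"
  proof (rule abelian_groupI)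
    fix f g assume f: "f \<in> carrier ?F" and g: "g \<in> carrier ?F"
    have "{x. f x \<oplus> g x \<noteq> \<zero>} \<subseteq> {x. f x \<noteq> \<zero>} \<union> {x. g x \<noteq> \<zero>}" by auto
    then show "f \<oplus>\<^bsub>?F\<^esub> g \<in> carrier ?F"
      using f g by (auto simp: free_module_def intro: finite_subset)
  next
    fix f assume f: "f \<in> carrier ?F"
    have "{x. \<ominus> f x \<noteq> \<zero>} \<subseteq> {x. f x \<noteq> \<zero>}" by auto
    then have "(\<lambda>x. \<ominus> f x) \<in> carrier ?F"
      using f finite_subset by (auto simp: free_module_def)
    moreover have "(\<lambda>x. \<ominus> f x) \<oplus>\<^bsub>?F\<^esub> f = \<zero>\<^bsub>?F\<^esub>"
      using f by (simp add: free_module_def l_neg)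
    ultimately show "\<exists>y\<in>carrier ?F. y \<oplus>\<^bsub>?F\<^esub> f = \<zero>\<^bsub>?F\<^esub>" by blast
  qed (auto simp: free_module_def a_ac)
  fix a f assume a: "a \<in> carrier R" and f: "f \<in> carrier ?F"
  have "{x. a \<otimes> f x \<noteq> \<zero>} \<subseteq> {x. f x \<noteq> \<zero>}" using a by auto
  then show "a \<odot>\<^bsub>?F\<^esub> f \<in> carrier ?F"
    using a f by (auto simp: free_module_def intro: finite_subset)
qed (auto simp: free_module_def l_distr r_distr m_assoc)

lemma (in cring) free_gen_closed [simp]: "x \<in> X \<Longrightarrow> free_gen R x \<in> carrier (free_module R X)"
  by (auto simp: free_module_def free_gen_def)

text \<open>
  Induction on a finite set containing the support, splitting off one coordinate at a time. Since the
  induction is additive, with multiples of basis elements as base case, it applies to properties that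
  are not preserved by scalar multiplication.
\<close>

lemma (in cring) free_module_induct [consumes 1, case_names zero gen add]:
  fixes X :: "'x set"
  assumes f: "f \<in> carrier (free_module R X)"
    and zero: "Q \<zero>\<^bsub>free_module R X\<^esub>"
    and gen: "\<And>c x. \<lbrakk>c \<in> carrier R; x \<in> X\<rbrakk> \<Longrightarrow> Q (c \<odot>\<^bsub>free_module R X\<^esub> free_gen R x)"
    and add: "\<And>f g. \<lbrakk>f \<in> carrier (free_module R X); g \<in> carrier (free_module R X); Q f; Q g\<rbrakk>
      \<Longrightarrow> Q (f \<oplus>\<^bsub>free_module R X\<^esub> g)"
  shows "Q f"
proof -
  let ?F = "free_module R X"
  interpret F: module R ?F by (rule free_module_is_module)
  have "\<forall>f\<in>carrier ?F. {x. f x \<noteq> \<zero>} \<subseteq> S \<longrightarrow> Q f" if "finite S" for S :: "'x set"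
    using that
  proof induction
    case empty
    show ?case
    proof (intro ballI impI)
      fix f :: "'x \<Rightarrow> 'a" assume "{x. f x \<noteq> \<zero>} \<subseteq> {}"
      then have "f = \<zero>\<^bsub>?F\<^esub>" by (auto simp: free_module_def)
      then show "Q f" using zero by simp
    qed
  next
    case (insert x S)
    show ?case
    proof (intro ballI impI)
      fix f assume f: "f \<in> carrier ?F" and supp: "{y. f y \<noteq> \<zero>} \<subseteq> insert x S"
      let ?g = "f(x := \<zero>)"
      have "{y. ?g y \<noteq> \<zero>} = {y. f y \<noteq> \<zero>} - {x}" by auto
      then have "finite {y. ?g y \<noteq> \<zero>}" using f by (simp only: free_module_def) simp
      then have g: "?g \<in> carrier ?F"
        using f by (simp add: free_module_def)
      moreover have "{y. ?g y \<noteq> \<zero>} \<subseteq> S" using supp by auto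
      ultimately have Qg: "Q ?g" using insert.IH by blast
      show "Q f"
      proof (cases "x \<in> X")
        case True
        have fx: "f x \<in> carrier R" using f by (auto simp: free_module_def)
        have "f = ?g \<oplus>\<^bsub>?F\<^esub> f x \<odot>\<^bsub>?F\<^esub> free_gen R x"
          using f by (auto simp: free_module_def free_gen_def)
        then show ?thesis
          using add[OF g _ Qg gen[OF fx True]] fx True by simp
      next
        case False
        then have "?g = f" using f by (auto simp: free_module_def)
        then show ?thesis using Qg by simp
      qed
    qed
  qed
  moreover have "finite {x. f x \<noteq> \<zero>}" using f by (simp add: free_module_def)
  ultimately show ?thesis using f by blast
qed

text \<open>
  An additive map on the free module may be prescribed on each line spanned by a basis element by an
  arbitrary additive function, linear or not. This freedom is what makes room for first-order
  differential operators.
\<close>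

lemma (in cring) free_module_additive_extension:
  assumes M: "abelian_group M"
    and closed: "\<And>c x. \<lbrakk>c \<in> carrier R; x \<in> X\<rbrakk> \<Longrightarrow> \<phi> c x \<in> carrier M"
    and add: "\<And>b c x. \<lbrakk>b \<in> carrier R; c \<in> carrier R; x \<in> X\<rbrakk> \<Longrightarrow>
      \<phi> (b \<oplus> c) x = \<phi> b x \<oplus>\<^bsub>M\<^esub> \<phi> c x"
  obtains T where "abelian_group_hom (free_module R X) M T"
    and "\<And>c x. \<lbrakk>c \<in> carrier R; x \<in> X\<rbrakk> \<Longrightarrow> T (c \<odot>\<^bsub>free_module R X\<^esub> free_gen R x) = \<phi> c x"
proof -
  let ?F = "free_module R X"
  interpret M: abelian_group M by (rule M)
  interpret F: module R ?F by (rule free_module_is_module)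
  define T where "T f = (\<Oplus>\<^bsub>M\<^esub>x\<in>{x. f x \<noteq> \<zero>}. \<phi> (f x) x)" for f
  have zero: "\<phi> \<zero> x = \<zero>\<^bsub>M\<^esub>" if "x \<in> X" for x
    using add[of \<zero> \<zero> x] closed[of \<zero> x] that by simp
  \<comment> \<open>summing over a larger set than the support allows the sums of two elements to be compared\<close>
  have T: "T f = (\<Oplus>\<^bsub>M\<^esub>x\<in>S. \<phi> (f x) x)"
    if f: "f \<in> carrier ?F" and S: "finite S" "{x. f x \<noteq> \<zero>} \<subseteq> S" "S \<subseteq> X" for f S
    unfolding T_def
    by (rule M.add.finprod_mono_neutral_cong_left)
       (use f S in \<open>auto simp: free_module_def zero closed subset_eq\<close>)
  have supp: "finite {x. f x \<noteq> \<zero>}" "{x. f x \<noteq> \<zero>} \<subseteq> X" if "f \<in> carrier ?F" for f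
    using that by (auto simp: free_module_def)
  have T_add: "T (f \<oplus>\<^bsub>?F\<^esub> g) = T f \<oplus>\<^bsub>M\<^esub> T g" if f: "f \<in> carrier ?F" and g: "g \<in> carrier ?F" for f g
  proof -
    let ?S = "{x. f x \<noteq> \<zero>} \<union> {x. g x \<noteq> \<zero>}"
    have S: "finite ?S" "?S \<subseteq> X" using supp f g by auto
    have fS: "f x \<in> carrier R" "g x \<in> carrier R" for x using f g by (auto simp: free_module_def)
    have "T (f \<oplus>\<^bsub>?F\<^esub> g) = (\<Oplus>\<^bsub>M\<^esub>x\<in>?S. \<phi> ((f \<oplus>\<^bsub>?F\<^esub> g) x) x)"
      by (rule T) (use F.a_closed[OF f g] f g S in \<open>auto simp: free_module_def\<close>)
    also have "\<dots> = (\<Oplus>\<^bsub>M\<^esub>x\<in>?S. \<phi> (f x) x \<oplus>\<^bsub>M\<^esub> \<phi> (g x) x)"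
      by (rule M.finsum_cong') (use S fS in \<open>auto simp: free_module_def add closed subset_eq\<close>)
    also have "\<dots> = (\<Oplus>\<^bsub>M\<^esub>x\<in>?S. \<phi> (f x) x) \<oplus>\<^bsub>M\<^esub> (\<Oplus>\<^bsub>M\<^esub>x\<in>?S. \<phi> (g x) x)"
      by (rule M.finsum_addf) (use S fS closed in auto)
    also have "\<dots> = T f \<oplus>\<^bsub>M\<^esub> T g"
      using T[OF f S(1) _ S(2)] T[OF g S(1) _ S(2)] by simp
    finally show ?thesis .
  qed
  show thesis
  proof (rule that)
    have "T f \<in> carrier M" if "f \<in> carrier ?F" for f
      unfolding T_def by (rule M.finsum_closed)
        (use that supp[OF that] closed in \<open>auto simp: free_module_def\<close>)
    then show "abelian_group_hom ?F M T"
      by (intro abelian_group_hom_of_additive F.abelian_group_axioms M T_add)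
  next
    fix c x assume c: "c \<in> carrier R" and x: "x \<in> X"
    let ?f = "c \<odot>\<^bsub>?F\<^esub> free_gen R x"
    have "T ?f = (\<Oplus>\<^bsub>M\<^esub>y\<in>{x}. \<phi> (?f y) y)"
      by (rule T) (use c x in \<open>auto simp: free_module_def free_gen_def\<close>)
    then show "T ?f = \<phi> c x"
      using c x closed by (simp add: free_module_def free_gen_def)
  qed
qed


section \<open>The module of differentials\<close>

locale kaehler_differentials = alg?: algebra R A
  for R :: "('r, 'k) ring_scheme" (structure) and A :: "('r, 'a, 'm) module_scheme" (structure)
begin

abbreviation F where "F \<equiv> free_module A (carrier A)"
abbreviation N where "N \<equiv> kaehler_submodule R A"
abbreviation D where "D \<equiv> kaehler R A"
abbreviation d where "d \<equiv> kaehler_d R A"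

sublocale F: module A F
  by (rule free_module_is_module)

lemma scalar_mult: "\<lbrakk>r \<in> carrier R; b \<in> carrier A\<rbrakk> \<Longrightarrow> (r \<odot>\<^bsub>A\<^esub> \<one>\<^bsub>A\<^esub>) \<otimes>\<^bsub>A\<^esub> b = r \<odot>\<^bsub>A\<^esub> b"
  by (simp add: smult_assoc2)

lemma kaehler_relations_subset: "kaehler_relations R A \<subseteq> carrier F"
  unfolding kaehler_relations_def Let_def by auto

lemma kaehler_submodule: "submodule N A F"
proof -
  let ?S = "\<Inter> {t. submodule t A F \<and> kaehler_relations R A \<subseteq> t}"
  have "submodule ?S A F"
  proof (rule F.submoduleI)
    show "?S \<subseteq> carrier F"
      using F.carrier_is_submodule kaehler_relations_subset by blast
    show "\<zero>\<^bsub>F\<^esub> \<in> ?S"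
      using subgroup.one_closed[OF submodule.axioms(1), of _ A F] by auto
  next
    fix f g assume f: "f \<in> ?S" and g: "g \<in> ?S"
    show "f \<oplus>\<^bsub>F\<^esub> g \<in> ?S" using f g F.submoduleE(5) by fastforce
  next
    fix f assume f: "f \<in> ?S"
    show "\<ominus>\<^bsub>F\<^esub> f \<in> ?S" using f F.submoduleE(3) by fastforce
  next
    fix a f assume a: "a \<in> carrier A" and f: "f \<in> ?S"
    show "a \<odot>\<^bsub>F\<^esub> f \<in> ?S" using a f F.submoduleE(4) by fastforce
  qed
  then show ?thesis by (simp add: kaehler_submodule_def hull_def)
qed

lemma kaehler_relation: "x \<in> kaehler_relations R A \<Longrightarrow> x \<in> N"
  unfolding kaehler_submodule_def by (rule hull_inc)

sublocale D: module A D
  unfolding kaehler_def by (rule F.quotient_module_is_module[OF kaehler_submodule])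

sublocale N: abelian_subgroup N F
  by (rule F.submodule_abelian_subgroup[OF kaehler_submodule])

abbreviation cls where "cls f \<equiv> N +>\<^bsub>F\<^esub> f"

lemma cls_closed [simp]: "f \<in> carrier F \<Longrightarrow> cls f \<in> carrier D"
  by (simp add: kaehler_def quotient_carrier)

lemma cls_surj: "x \<in> carrier D \<Longrightarrow> \<exists>f\<in>carrier F. x = cls f"
  by (auto simp add: kaehler_def quotient_carrier)

lemma cls_add: "\<lbrakk>f \<in> carrier F; g \<in> carrier F\<rbrakk> \<Longrightarrow> cls (f \<oplus>\<^bsub>F\<^esub> g) = cls f \<oplus>\<^bsub>D\<^esub> cls g"
  by (simp add: kaehler_def F.quotient_add[OF kaehler_submodule])

lemma cls_smult: "\<lbrakk>a \<in> carrier A; f \<in> carrier F\<rbrakk> \<Longrightarrow> cls (a \<odot>\<^bsub>F\<^esub> f) = a \<odot>\<^bsub>D\<^esub> cls f"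
  by (simp add: kaehler_def F.quotient_smult[OF kaehler_submodule])

lemma zero_kaehler: "\<zero>\<^bsub>D\<^esub> = N"
  by (simp add: kaehler_def quotient_module_def)

lemma cls_zero_iff: "f \<in> carrier F \<Longrightarrow> cls f = \<zero>\<^bsub>D\<^esub> \<longleftrightarrow> f \<in> N"
  using N.a_rcos_self[of f] N.a_rcos_const by (auto simp: zero_kaehler)

lemma cls_zero: "cls \<zero>\<^bsub>F\<^esub> = \<zero>\<^bsub>D\<^esub>"
  using N.zero_closed cls_zero_iff by blast

lemma cls_eq_iff:
  assumes f: "f \<in> carrier F" and g: "g \<in> carrier F"
  shows "cls f = cls g \<longleftrightarrow> f \<ominus>\<^bsub>F\<^esub> g \<in> N"
proof -
  have "f \<in> cls g \<longleftrightarrow> f \<ominus>\<^bsub>F\<^esub> g \<in> N"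
    using N.a_rcos_module[OF g f] by (simp add: F.minus_eq)
  moreover have "f \<in> cls g \<longleftrightarrow> cls f = cls g"
    using N.a_rcos_self[OF f] N.a_repr_independence'[OF _ g, of f] by auto
  ultimately show ?thesis by simp
qed

lemma d_closed [simp, intro]: "a \<in> carrier A \<Longrightarrow> d a \<in> carrier D"
  by (simp add: kaehler_d_def)

lemma d_add:
  assumes b: "b \<in> carrier A" and c: "c \<in> carrier A"
  shows "d (b \<oplus>\<^bsub>A\<^esub> c) = d b \<oplus>\<^bsub>D\<^esub> d c"
proof -
  have "free_gen A (b \<oplus>\<^bsub>A\<^esub> c) \<ominus>\<^bsub>F\<^esub> (free_gen A b \<oplus>\<^bsub>F\<^esub> free_gen A c) \<in> N"
    by (rule kaehler_relation) (use b c in \<open>auto simp: kaehler_relations_def Let_def\<close>)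
  then show ?thesis
    unfolding kaehler_d_def using b c by (simp add: cls_eq_iff flip: cls_add)
qed

lemma d_smult:
  assumes r: "r \<in> carrier R" and b: "b \<in> carrier A"
  shows "d (r \<odot>\<^bsub>A\<^esub> b) = (r \<odot>\<^bsub>A\<^esub> \<one>\<^bsub>A\<^esub>) \<odot>\<^bsub>D\<^esub> d b"
proof -
  have "free_gen A (r \<odot>\<^bsub>A\<^esub> b) \<ominus>\<^bsub>F\<^esub> (r \<odot>\<^bsub>A\<^esub> \<one>\<^bsub>A\<^esub>) \<odot>\<^bsub>F\<^esub> free_gen A b \<in> N"
    by (rule kaehler_relation) (use b r in \<open>auto simp: kaehler_relations_def Let_def\<close>)
  then show ?thesis
    unfolding kaehler_d_def using r b by (simp add: cls_eq_iff flip: cls_smult)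
qed

lemma d_mult:
  assumes b: "b \<in> carrier A" and c: "c \<in> carrier A"
  shows "d (b \<otimes>\<^bsub>A\<^esub> c) = c \<odot>\<^bsub>D\<^esub> d b \<oplus>\<^bsub>D\<^esub> b \<odot>\<^bsub>D\<^esub> d c"
proof -
  have "free_gen A (b \<otimes>\<^bsub>A\<^esub> c) \<ominus>\<^bsub>F\<^esub> (c \<odot>\<^bsub>F\<^esub> free_gen A b \<oplus>\<^bsub>F\<^esub> b \<odot>\<^bsub>F\<^esub> free_gen A c) \<in> N"
    by (rule kaehler_relation) (use b c in \<open>auto simp: kaehler_relations_def Let_def\<close>)
  then show ?thesis
    unfolding kaehler_d_def using b c by (simp add: cls_eq_iff flip: cls_smult cls_add)
qed

text \<open>
  As the base case covers all \<open>a du\<close> and not only \<open>du\<close>, this induction proves statements that are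
  additive without being \<open>A\<close>-linear.
\<close>

lemma kaehler_induct [consumes 1, case_names gen add]:
  assumes x: "x \<in> carrier D"
    and gen: "\<And>a u. \<lbrakk>a \<in> carrier A; u \<in> carrier A\<rbrakk> \<Longrightarrow> Q (a \<odot>\<^bsub>D\<^esub> d u)"
    and add: "\<And>x y. \<lbrakk>x \<in> carrier D; y \<in> carrier D; Q x; Q y\<rbrakk> \<Longrightarrow> Q (x \<oplus>\<^bsub>D\<^esub> y)"
  shows "Q x"
proof -
  obtain f where f: "f \<in> carrier F" and xf: "x = cls f" using cls_surj[OF x] by blast
  from f have "Q (cls f)"
  proof (induction rule: free_module_induct)
    case zero
    have "\<zero>\<^bsub>A\<^esub> \<odot>\<^bsub>D\<^esub> d \<zero>\<^bsub>A\<^esub> = cls \<zero>\<^bsub>F\<^esub>"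
      by (simp add: cls_zero)
    then show ?case using gen[of "\<zero>\<^bsub>A\<^esub>" "\<zero>\<^bsub>A\<^esub>"] by simp
  next
    case (gen c v)
    then show ?case using assms(2)[of c v] by (simp add: cls_smult kaehler_d_def)
  next
    case (add f g)
    then show ?case using assms(3) by (simp add: cls_add)
  qed
  then show ?thesis by (simp add: xf)
qed

lemma derivationD:
  assumes "\<delta> \<in> derivations R A"
  shows "a \<in> carrier A \<Longrightarrow> \<delta> a \<in> carrier A"
    and "\<lbrakk>a \<in> carrier A; b \<in> carrier A\<rbrakk> \<Longrightarrow> \<delta> (a \<oplus>\<^bsub>A\<^esub> b) = \<delta> a \<oplus>\<^bsub>A\<^esub> \<delta> b"
    and "\<lbrakk>a \<in> carrier A; b \<in> carrier A\<rbrakk> \<Longrightarrow> \<delta> (a \<otimes>\<^bsub>A\<^esub> b) = \<delta> a \<otimes>\<^bsub>A\<^esub> b \<oplus>\<^bsub>A\<^esub> a \<otimes>\<^bsub>A\<^esub> \<delta> b"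
    and "\<lbrakk>r \<in> carrier R; a \<in> carrier A\<rbrakk> \<Longrightarrow> \<delta> (r \<odot>\<^bsub>A\<^esub> a) = r \<odot>\<^bsub>A\<^esub> \<delta> a"
  using assms by (auto simp: derivations_def linear_maps_def)

lemma derivation_one:
  assumes "\<delta> \<in> derivations R A"
  shows "\<delta> \<one>\<^bsub>A\<^esub> = \<zero>\<^bsub>A\<^esub>"
  using derivationD(3)[OF assms, of "\<one>\<^bsub>A\<^esub>" "\<one>\<^bsub>A\<^esub>"] derivationD(1)[OF assms, of "\<one>\<^bsub>A\<^esub>"]
  by simp

lemma derivation_scalar:
  assumes "\<delta> \<in> derivations R A" and "r \<in> carrier R"
  shows "\<delta> (r \<odot>\<^bsub>A\<^esub> \<one>\<^bsub>A\<^esub>) = \<zero>\<^bsub>A\<^esub>"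
  using derivationD(4)[OF assms(1), of r "\<one>\<^bsub>A\<^esub>"] derivation_one[OF assms(1)] assms(2)
  by simp

text \<open>
  The universal property of \<open>D\<close> for first-order operators: \<open>L(b y) = b L(y) + \<delta>(b) j(y)\<close>, with
  prescribed values \<open>g\<close> on exact differentials. The condition on \<open>g(v w)\<close> is what this rule forces on
  \<open>d(v w) = w dv + v dw\<close>. For \<open>\<delta> = 0\<close>, \<open>j = 0\<close> it says that derivations \<open>A \<rightarrow> M\<close> factor through linear
  maps \<open>D \<rightarrow> M\<close>; for \<open>j = id\<close> it produces operators on \<open>D\<close> that
  behave like Lie derivatives along \<open>\<delta>\<close>.
\<close>

lemma twisted_extension:
  assumes M: "module A M" and \<delta>: "\<delta> \<in> derivations R A"
    and j: "abelian_group_hom D M j"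
    and j_smult: "\<And>a x. \<lbrakk>a \<in> carrier A; x \<in> carrier D\<rbrakk> \<Longrightarrow> j (a \<odot>\<^bsub>D\<^esub> x) = a \<odot>\<^bsub>M\<^esub> j x"
    and g_closed: "\<And>v. v \<in> carrier A \<Longrightarrow> g v \<in> carrier M"
    and g_add: "\<And>v w. \<lbrakk>v \<in> carrier A; w \<in> carrier A\<rbrakk> \<Longrightarrow> g (v \<oplus>\<^bsub>A\<^esub> w) = g v \<oplus>\<^bsub>M\<^esub> g w"
    and g_smult: "\<And>r v. \<lbrakk>r \<in> carrier R; v \<in> carrier A\<rbrakk> \<Longrightarrow>
      g (r \<odot>\<^bsub>A\<^esub> v) = (r \<odot>\<^bsub>A\<^esub> \<one>\<^bsub>A\<^esub>) \<odot>\<^bsub>M\<^esub> g v"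
    and g_mult: "\<And>v w. \<lbrakk>v \<in> carrier A; w \<in> carrier A\<rbrakk> \<Longrightarrow>
      g (v \<otimes>\<^bsub>A\<^esub> w) = (w \<odot>\<^bsub>M\<^esub> g v \<oplus>\<^bsub>M\<^esub> v \<odot>\<^bsub>M\<^esub> g w)
        \<oplus>\<^bsub>M\<^esub> (\<delta> w \<odot>\<^bsub>M\<^esub> j (d v) \<oplus>\<^bsub>M\<^esub> \<delta> v \<odot>\<^bsub>M\<^esub> j (d w))"
  obtains L where "abelian_group_hom D M L"
    and "\<And>b y. \<lbrakk>b \<in> carrier A; y \<in> carrier D\<rbrakk> \<Longrightarrow>
      L (b \<odot>\<^bsub>D\<^esub> y) = b \<odot>\<^bsub>M\<^esub> L y \<oplus>\<^bsub>M\<^esub> \<delta> b \<odot>\<^bsub>M\<^esub> j y"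
    and "\<And>v. v \<in> carrier A \<Longrightarrow> L (d v) = g v"
proof -
  interpret M: module A M by (rule M)
  interpret j: abelian_group_hom D M j by (rule j)
  note \<delta>_simps = derivationD[OF \<delta>] derivation_one[OF \<delta>] derivation_scalar[OF \<delta>]
  obtain T where T: "abelian_group_hom F M T"
    and T_gen: "\<And>c v. \<lbrakk>c \<in> carrier A; v \<in> carrier A\<rbrakk> \<Longrightarrow>
      T (c \<odot>\<^bsub>F\<^esub> free_gen A v) = c \<odot>\<^bsub>M\<^esub> g v \<oplus>\<^bsub>M\<^esub> \<delta> c \<odot>\<^bsub>M\<^esub> j (d v)"
    by (rule free_module_additive_extension[OF M.abelian_group_axioms,
          where X = "carrier A" and \<phi> = "\<lambda>c v. c \<odot>\<^bsub>M\<^esub> g v \<oplus>\<^bsub>M\<^esub> \<delta> c \<odot>\<^bsub>M\<^esub> j (d v)"])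
      (auto simp: \<delta>_simps g_closed M.smult_l_distr M.M.a_ac)
  interpret T: abelian_group_hom F M T by (rule T)
  have T_e: "T (free_gen A v) = g v" if "v \<in> carrier A" for v
    using T_gen[of "\<one>\<^bsub>A\<^esub>" v] that by (simp add: \<delta>_simps g_closed)
  have T_diff: "T (f \<ominus>\<^bsub>F\<^esub> h) = \<zero>\<^bsub>M\<^esub>"
    if "f \<in> carrier F" "h \<in> carrier F" "T h = T f" for f h
    using that by (simp add: F.M.minus_eq M.M.r_neg)
  have T_smult: "T (b \<odot>\<^bsub>F\<^esub> f) = b \<odot>\<^bsub>M\<^esub> T f \<oplus>\<^bsub>M\<^esub> \<delta> b \<odot>\<^bsub>M\<^esub> j (cls f)"
    if b: "b \<in> carrier A" and f: "f \<in> carrier F" for b f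
    using f
  proof (induction rule: free_module_induct)
    case zero
    show ?case using b by (simp add: cls_zero \<delta>_simps)
  next
    case (gen c v)
    have "b \<odot>\<^bsub>F\<^esub> (c \<odot>\<^bsub>F\<^esub> free_gen A v) = (b \<otimes>\<^bsub>A\<^esub> c) \<odot>\<^bsub>F\<^esub> free_gen A v"
      using b gen by (simp add: F.smult_assoc1)
    moreover have "cls (c \<odot>\<^bsub>F\<^esub> free_gen A v) = c \<odot>\<^bsub>D\<^esub> d v"
      using gen by (simp add: cls_smult kaehler_d_def)
    ultimately show ?case using b gen
      by (simp add: T_gen j_smult \<delta>_simps g_closed M.smult_l_distr M.smult_r_distr M.M.a_ac
          m_comm flip: M.smult_assoc1)
  next
    case (add f g)
    then show ?case using b
      by (simp add: F.smult_r_distr cls_add \<delta>_simps M.smult_r_distr M.M.a_ac)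
  qed
  \<comment> \<open>on \<open>N\<close> the operator is linear, since there the correction term \<open>\<delta>(b) j(cls f)\<close>
    vanishes; so its kernel in \<open>N\<close> is a submodule\<close>
  define K where "K = {f \<in> N. T f = \<zero>\<^bsub>M\<^esub>}"
  have "submodule K A F"
  proof (rule F.submoduleI)
    fix b f assume b: "b \<in> carrier A" and f: "f \<in> K"
    then have "f \<in> carrier F" "cls f = \<zero>\<^bsub>D\<^esub>"
      using N.a_subset by (auto simp: K_def cls_zero_iff)
    then show "b \<odot>\<^bsub>F\<^esub> f \<in> K"
      using b f F.submoduleE(4)[OF kaehler_submodule] by (simp add: K_def T_smult \<delta>_simps)
  qed (use F.submoduleE[OF kaehler_submodule] N.a_subset in \<open>auto simp: K_def\<close>)
  moreover have "kaehler_relations R A \<subseteq> K"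
  proof
    fix x assume x: "x \<in> kaehler_relations R A"
    have "T x = \<zero>\<^bsub>M\<^esub>"
      using x unfolding kaehler_relations_def Let_def
    proof (elim UnE CollectE exE conjE)
      fix b c assume x: "x = free_gen A (b \<oplus>\<^bsub>A\<^esub> c) \<ominus>\<^bsub>F\<^esub> (free_gen A b \<oplus>\<^bsub>F\<^esub> free_gen A c)"
        and bc: "b \<in> carrier A" "c \<in> carrier A"
      then show ?thesis
        by (simp add: F.M.minus_eq T_e g_add g_closed M.M.r_neg)
    next
      fix r b assume x: "x = free_gen A (r \<odot>\<^bsub>A\<^esub> b) \<ominus>\<^bsub>F\<^esub> (r \<odot>\<^bsub>A\<^esub> \<one>\<^bsub>A\<^esub>) \<odot>\<^bsub>F\<^esub> free_gen A b"
        and rb: "r \<in> carrier R" "b \<in> carrier A"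
      then show ?thesis
        by (simp add: F.M.minus_eq T_e T_gen \<delta>_simps g_smult g_closed M.M.r_neg)
    next
      fix b c assume x: "x = free_gen A (b \<otimes>\<^bsub>A\<^esub> c) \<ominus>\<^bsub>F\<^esub>
          (c \<odot>\<^bsub>F\<^esub> free_gen A b \<oplus>\<^bsub>F\<^esub> b \<odot>\<^bsub>F\<^esub> free_gen A c)"
        and bc: "b \<in> carrier A" "c \<in> carrier A"
      have "T (c \<odot>\<^bsub>F\<^esub> free_gen A b \<oplus>\<^bsub>F\<^esub> b \<odot>\<^bsub>F\<^esub> free_gen A c) = T (free_gen A (b \<otimes>\<^bsub>A\<^esub> c))"
        using bc by (simp add: T_e T_gen \<delta>_simps g_mult g_closed M.M.a_ac)
      then show ?thesis
        using bc by (simp add: x T_diff del: T.hom_add)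
    next
      fix r assume x: "x = free_gen A (r \<odot>\<^bsub>A\<^esub> \<one>\<^bsub>A\<^esub>)" and r: "r \<in> carrier R"
      have "g \<one>\<^bsub>A\<^esub> = g \<one>\<^bsub>A\<^esub> \<oplus>\<^bsub>M\<^esub> g \<one>\<^bsub>A\<^esub>"
        using g_mult[of "\<one>\<^bsub>A\<^esub>" "\<one>\<^bsub>A\<^esub>"] by (simp add: \<delta>_simps g_closed)
      then have "g \<one>\<^bsub>A\<^esub> = \<zero>\<^bsub>M\<^esub>"
        using g_closed[of "\<one>\<^bsub>A\<^esub>"] by simp
      then show ?thesis using r by (simp add: x T_e g_smult)
    qed
    then show "x \<in> K" using kaehler_relation[OF x] by (simp add: K_def)
  qed
  ultimately have "N \<subseteq> K"
    unfolding kaehler_submodule_def by (intro hull_minimal)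
  then have T_N: "T f = \<zero>\<^bsub>M\<^esub>" if "f \<in> N" for f using that by (auto simp: K_def)
  define L where "L x = T (SOME f. f \<in> carrier F \<and> x = cls f)" for x
  have L: "L (cls f) = T f" if f: "f \<in> carrier F" for f
  proof -
    define f' where "f' = (SOME g. g \<in> carrier F \<and> cls f = cls g)"
    have f': "f' \<in> carrier F" "cls f = cls f'"
      using someI[of "\<lambda>g. g \<in> carrier F \<and> cls f = cls g" f] f by (auto simp: f'_def)
    then have "f \<ominus>\<^bsub>F\<^esub> f' \<in> N" using f cls_eq_iff by blast
    then have "T (f \<ominus>\<^bsub>F\<^esub> f' \<oplus>\<^bsub>F\<^esub> f') = T f'" using T_N f f' by simp
    moreover have "f \<ominus>\<^bsub>F\<^esub> f' \<oplus>\<^bsub>F\<^esub> f' = f" using f f' by (simp add: F.M.minus_eq F.M.a_assoc F.M.l_neg)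
    ultimately have "T f = T f'" by simp
    then show ?thesis by (simp add: L_def f'_def)
  qed
  show thesis
  proof (rule that)
    have "L x \<in> carrier M" if "x \<in> carrier D" for x
      using cls_surj[OF that] L by auto
    moreover have "L (x \<oplus>\<^bsub>D\<^esub> y) = L x \<oplus>\<^bsub>M\<^esub> L y" if x: "x \<in> carrier D" and y: "y \<in> carrier D" for x y
      using cls_surj[OF x] cls_surj[OF y] by (auto simp: L simp flip: cls_add)
    ultimately show "abelian_group_hom D M L"
      by (intro abelian_group_hom_of_additive D.abelian_group_axioms M.abelian_group_axioms)
  next
    fix b y assume b: "b \<in> carrier A" and y: "y \<in> carrier D"
    then show "L (b \<odot>\<^bsub>D\<^esub> y) = b \<odot>\<^bsub>M\<^esub> L y \<oplus>\<^bsub>M\<^esub> \<delta> b \<odot>\<^bsub>M\<^esub> j y"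
      using cls_surj[OF y] by (auto simp: L T_smult simp flip: cls_smult)
  next
    fix v assume v: "v \<in> carrier A"
    then show "L (d v) = g v" by (simp add: kaehler_d_def L T_e)
  qed
qed

end

section \<open>Biadditive maps on differentials\<close>

context kaehler_differentials
begin

definition biadditive :: "('c, 'e) ring_scheme \<Rightarrow> (('a \<Rightarrow> 'a) set \<Rightarrow> ('a \<Rightarrow> 'a) set \<Rightarrow> 'c) \<Rightarrow> bool"
  where "biadditive M B \<longleftrightarrow>
    (\<forall>x\<in>carrier D. \<forall>y\<in>carrier D. B x y \<in> carrier M) \<and>
    (\<forall>x\<in>carrier D. \<forall>x'\<in>carrier D. \<forall>y\<in>carrier D. B (x \<oplus>\<^bsub>D\<^esub> x') y = B x y \<oplus>\<^bsub>M\<^esub> B x' y) \<and>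
    (\<forall>x\<in>carrier D. \<forall>y\<in>carrier D. \<forall>y'\<in>carrier D. B x (y \<oplus>\<^bsub>D\<^esub> y') = B x y \<oplus>\<^bsub>M\<^esub> B x y')"

lemma biadditiveD:
  assumes "biadditive M B"
  shows "\<lbrakk>x \<in> carrier D; y \<in> carrier D\<rbrakk> \<Longrightarrow> B x y \<in> carrier M"
    and "\<lbrakk>x \<in> carrier D; x' \<in> carrier D; y \<in> carrier D\<rbrakk> \<Longrightarrow> B (x \<oplus>\<^bsub>D\<^esub> x') y = B x y \<oplus>\<^bsub>M\<^esub> B x' y"
    and "\<lbrakk>x \<in> carrier D; y \<in> carrier D; y' \<in> carrier D\<rbrakk> \<Longrightarrow> B x (y \<oplus>\<^bsub>D\<^esub> y') = B x y \<oplus>\<^bsub>M\<^esub> B x y'"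
  using assms by (auto simp: biadditive_def)

lemma biadditive_eqI:
  assumes B: "biadditive M B" and B': "biadditive M B'"
    and gen: "\<And>a u b v. \<lbrakk>a \<in> carrier A; u \<in> carrier A; b \<in> carrier A; v \<in> carrier A\<rbrakk> \<Longrightarrow>
      B (a \<odot>\<^bsub>D\<^esub> d u) (b \<odot>\<^bsub>D\<^esub> d v) = B' (a \<odot>\<^bsub>D\<^esub> d u) (b \<odot>\<^bsub>D\<^esub> d v)"
    and x: "x \<in> carrier D" and y: "y \<in> carrier D"
  shows "B x y = B' x y"
  using x
proof (induction rule: kaehler_induct)
  case au: (gen a u)
  from y show ?case
    by (induction rule: kaehler_induct)
      (use au in \<open>simp_all add: gen biadditiveD[OF B] biadditiveD[OF B']\<close>)
next
  case (add x x')
  then show ?case using y by (simp add: biadditiveD[OF B] biadditiveD[OF B'])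
qed

text \<open>
  Antisymmetry is itself an equality of two biadditive maps, so it propagates from generators. Being
  alternating is not additive in a single variable, and is therefore derived from antisymmetry next.
\<close>

lemma biadditive_antisym:
  assumes M: "abelian_group M" and B: "biadditive M B"
    and gen: "\<And>a u b v. \<lbrakk>a \<in> carrier A; u \<in> carrier A; b \<in> carrier A; v \<in> carrier A\<rbrakk> \<Longrightarrow>
      B (a \<odot>\<^bsub>D\<^esub> d u) (b \<odot>\<^bsub>D\<^esub> d v) = \<ominus>\<^bsub>M\<^esub> B (b \<odot>\<^bsub>D\<^esub> d v) (a \<odot>\<^bsub>D\<^esub> d u)"
    and x: "x \<in> carrier D" and y: "y \<in> carrier D"
  shows "B x y = \<ominus>\<^bsub>M\<^esub> B y x"
proof -
  interpret M: abelian_group M by (rule M)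
  have "biadditive M (\<lambda>x y. \<ominus>\<^bsub>M\<^esub> B y x)"
    using biadditiveD[OF B] by (auto simp: biadditive_def M.minus_add)
  from biadditive_eqI[OF B this gen x y] show ?thesis .
qed

lemma biadditive_alternating:
  assumes M: "abelian_group M" and B: "biadditive M B"
    and gen: "\<And>a u b v. \<lbrakk>a \<in> carrier A; u \<in> carrier A; b \<in> carrier A; v \<in> carrier A\<rbrakk> \<Longrightarrow>
      B (a \<odot>\<^bsub>D\<^esub> d u) (b \<odot>\<^bsub>D\<^esub> d v) = \<ominus>\<^bsub>M\<^esub> B (b \<odot>\<^bsub>D\<^esub> d v) (a \<odot>\<^bsub>D\<^esub> d u)"
    and diag: "\<And>a u. \<lbrakk>a \<in> carrier A; u \<in> carrier A\<rbrakk> \<Longrightarrow>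
      B (a \<odot>\<^bsub>D\<^esub> d u) (a \<odot>\<^bsub>D\<^esub> d u) = \<zero>\<^bsub>M\<^esub>"
    and x: "x \<in> carrier D"
  shows "B x x = \<zero>\<^bsub>M\<^esub>"
proof -
  interpret M: abelian_group M by (rule M)
  from x show ?thesis
  proof (induction rule: kaehler_induct)
    case (gen a u)
    then show ?case by (rule diag)
  next
    case (add x y)
    have "B x y = \<ominus>\<^bsub>M\<^esub> B y x" by (rule biadditive_antisym[OF M B gen add.hyps]) 
    then show ?case using add by (simp add: biadditiveD[OF B] M.l_neg M.r_neg)
  qed
qed

text \<open>
  Let \<open>x = \<Sum>\<^sub>i a\<^sub>i du\<^sub>i\<close>. The sum of the maps \<open>\<Phi> a\<^sub>i u\<^sub>i\<close> takes the value \<open>- \<Phi> b v x\<close> at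
  \<open>b dv\<close>, so it does not depend on how \<open>x\<close> is written. This is phrased without sums: every \<open>x\<close> admits an
  additive map \<open>\<psi>\<close> with \<open>\<psi>(b dv) = - \<Phi> b v x\<close>, by induction on \<open>x\<close>, and such a map is unique because
  the elements \<open>b dv\<close> generate.
\<close>

lemma biadditive_extension:
  assumes M: "abelian_group M"
    and \<Phi>: "\<And>a u. \<lbrakk>a \<in> carrier A; u \<in> carrier A\<rbrakk> \<Longrightarrow> abelian_group_hom D M (\<Phi> a u)"
    and antisym: "\<And>a u b v. \<lbrakk>a \<in> carrier A; u \<in> carrier A; b \<in> carrier A; v \<in> carrier A\<rbrakk> \<Longrightarrow>
      \<Phi> a u (b \<odot>\<^bsub>D\<^esub> d v) = \<ominus>\<^bsub>M\<^esub> \<Phi> b v (a \<odot>\<^bsub>D\<^esub> d u)"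
  obtains B where "biadditive M B" and "B \<in> carrier D \<rightarrow>\<^sub>E (carrier D \<rightarrow>\<^sub>E carrier M)"
    and "\<And>a u y. \<lbrakk>a \<in> carrier A; u \<in> carrier A; y \<in> carrier D\<rbrakk> \<Longrightarrow> B (a \<odot>\<^bsub>D\<^esub> d u) y = \<Phi> a u y"
proof -
  interpret M: abelian_group M by (rule M)
  let ?ext = "\<lambda>x \<psi>. abelian_group_hom D M \<psi> \<and>
    (\<forall>b\<in>carrier A. \<forall>v\<in>carrier A. \<psi> (b \<odot>\<^bsub>D\<^esub> d v) = \<ominus>\<^bsub>M\<^esub> \<Phi> b v x)"
  have ext_add: "?ext (x \<oplus>\<^bsub>D\<^esub> x') (\<lambda>y. \<psi> y \<oplus>\<^bsub>M\<^esub> \<psi>' y)"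
    if x: "x \<in> carrier D" "x' \<in> carrier D" and \<psi>: "?ext x \<psi>" and \<psi>': "?ext x' \<psi>'" for x x' \<psi> \<psi>'
  proof -
    interpret p: abelian_group_hom D M \<psi> using \<psi> by blast
    interpret p': abelian_group_hom D M \<psi>' using \<psi>' by blast
    have "abelian_group_hom D M (\<lambda>y. \<psi> y \<oplus>\<^bsub>M\<^esub> \<psi>' y)"
      by (rule abelian_group_hom_of_additive)
        (simp_all add: D.abelian_group_axioms M M.a_ac)
    moreover have "\<psi> (b \<odot>\<^bsub>D\<^esub> d v) \<oplus>\<^bsub>M\<^esub> \<psi>' (b \<odot>\<^bsub>D\<^esub> d v) = \<ominus>\<^bsub>M\<^esub> \<Phi> b v (x \<oplus>\<^bsub>D\<^esub> x')"
      if bv: "b \<in> carrier A" "v \<in> carrier A" for b v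
    proof -
      interpret bv: abelian_group_hom D M "\<Phi> b v" by (rule \<Phi>[OF bv])
      show ?thesis using \<psi> \<psi>' bv x by (simp add: M.minus_add)
    qed
    ultimately show ?thesis by blast
  qed
  have ext_gen: "?ext (a \<odot>\<^bsub>D\<^esub> d u) (\<Phi> a u)" if "a \<in> carrier A" "u \<in> carrier A" for a u
    using that antisym \<Phi> by blast
  have "\<exists>\<psi>. ?ext x \<psi>" if "x \<in> carrier D" for x
    using that
  proof (induction rule: kaehler_induct)
    case (gen a u)
    then show ?case using ext_gen by blast
  next
    case (add x y)
    then show ?case using ext_add by blast
  qed
  then obtain \<Psi> where \<Psi>: "\<And>x. x \<in> carrier D \<Longrightarrow> ?ext x (\<Psi> x)" by metis
  have unique: "\<psi> y = \<psi>' y" if \<psi>: "?ext x \<psi>" and \<psi>': "?ext x \<psi>'" and y: "y \<in> carrier D" for x \<psi> \<psi>' y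
  proof -
    interpret p: abelian_group_hom D M \<psi> using \<psi> by blast
    interpret p': abelian_group_hom D M \<psi>' using \<psi>' by blast
    from y show ?thesis
      by (induction rule: kaehler_induct) (use \<psi> \<psi>' in auto)
  qed
  define B where "B = (\<lambda>x\<in>carrier D. \<lambda>y\<in>carrier D. \<Psi> x y)"
  have \<Psi>_hom: "abelian_group_hom D M (\<Psi> x)" if "x \<in> carrier D" for x
    using \<Psi>[OF that] by blast
  note \<Psi>_simps = abelian_group_hom.hom_add[OF \<Psi>_hom] abelian_group_hom.hom_closed[OF \<Psi>_hom]
  show thesis
  proof (rule that)
    have "\<Psi> (x \<oplus>\<^bsub>D\<^esub> x') y = \<Psi> x y \<oplus>\<^bsub>M\<^esub> \<Psi> x' y"
      if x: "x \<in> carrier D" "x' \<in> carrier D" "y \<in> carrier D" for x x' y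
      by (rule unique[OF \<Psi> ext_add[OF x(1,2) \<Psi> \<Psi>] x(3)]) (use x in simp_all)
    then show "biadditive M B"
      by (simp add: biadditive_def B_def \<Psi>_simps)
    show "B \<in> carrier D \<rightarrow>\<^sub>E (carrier D \<rightarrow>\<^sub>E carrier M)"
      by (auto simp: B_def \<Psi>_simps)
  next
    fix a u y assume a: "a \<in> carrier A" "u \<in> carrier A" and y: "y \<in> carrier D"
    then have "\<Psi> (a \<odot>\<^bsub>D\<^esub> d u) y = \<Phi> a u y"
      by (intro unique[OF \<Psi> ext_gen y]) simp_all
    then show "B (a \<odot>\<^bsub>D\<^esub> d u) y = \<Phi> a u y" using a y by (simp add: B_def)
  qed
qed

end

section \<open>The form and the bracket of a Poisson algebra\<close>

lemma self_module_simps [simp]: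
  "carrier (self_module A) = carrier A" "\<zero>\<^bsub>self_module A\<^esub> = \<zero>\<^bsub>A\<^esub>"
  "x \<oplus>\<^bsub>self_module A\<^esub> y = x \<oplus>\<^bsub>A\<^esub> y" "x \<odot>\<^bsub>self_module A\<^esub> y = x \<otimes>\<^bsub>A\<^esub> y"
  by (simp_all add: self_module_def)

lemma (in cring) self_module_is_module: "module R (self_module R)"
proof (rule moduleI)
  show "abelian_group (self_module R)"
    by (rule abelian_groupI) (auto simp: a_ac intro: bexI[of _ "\<ominus> x" for x] l_neg)
qed (auto simp: is_cring l_distr r_distr m_assoc)

locale poisson_differentials = kaehler_differentials R A + poisson: poisson_algebra R A P
  for R :: "('r, 'k) ring_scheme" (structure) and A :: "('r, 'a, 'm) module_scheme" (structure)
    and P :: "'a \<Rightarrow> 'a \<Rightarrow> 'a"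
begin

lemmas P_closed [simp] = poisson.lie.bracket_closed
lemmas P_add_left = poisson.lie.bracket_add_left
lemmas P_add_right = poisson.lie.bracket_add_right
lemmas P_smult_right = poisson.lie.bracket_smult_right

lemma P_antisym:
  assumes u: "u \<in> carrier A" and v: "v \<in> carrier A"
  shows "P u v = \<ominus>\<^bsub>A\<^esub> P v u"
proof -
  have "P (u \<oplus>\<^bsub>A\<^esub> v) (u \<oplus>\<^bsub>A\<^esub> v) = P u v \<oplus>\<^bsub>A\<^esub> P v u"
    using u v by (simp add: P_add_left P_add_right poisson.lie.bracket_self[OF u]
        poisson.lie.bracket_self[OF v] a_comm)
  moreover have "P (u \<oplus>\<^bsub>A\<^esub> v) (u \<oplus>\<^bsub>A\<^esub> v) = \<zero>\<^bsub>A\<^esub>"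
    using u v by (intro poisson.lie.bracket_self) simp
  ultimately have "P u v \<oplus>\<^bsub>A\<^esub> P v u = \<zero>\<^bsub>A\<^esub>" by simp
  then show ?thesis using u v by (simp add: minus_equality)
qed

lemma P_mult_right:
  assumes u: "u \<in> carrier A" and v: "v \<in> carrier A" and w: "w \<in> carrier A"
  shows "P u (v \<otimes>\<^bsub>A\<^esub> w) = w \<otimes>\<^bsub>A\<^esub> P u v \<oplus>\<^bsub>A\<^esub> v \<otimes>\<^bsub>A\<^esub> P u w"
  using u v w P_antisym[of u "v \<otimes>\<^bsub>A\<^esub> w"] P_antisym[of v u] P_antisym[of w u]
  by (simp add: poisson.poisson_mult minus_add l_minus r_minus a_comm m_comm)

text \<open>
  This is \<open>\<pi>\<^sup>\<sharp>(a du)\<close>, the Hamiltonian derivation of \<open>u\<close> scaled by \<open>a\<close>.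
\<close>

lemma hamiltonian_derivation:
  assumes a: "a \<in> carrier A" and u: "u \<in> carrier A"
  shows "(\<lambda>v\<in>carrier A. a \<otimes>\<^bsub>A\<^esub> P u v) \<in> derivations R A"
proof -
  have "a \<otimes>\<^bsub>A\<^esub> P u (r \<odot>\<^bsub>A\<^esub> v) = r \<odot>\<^bsub>A\<^esub> (a \<otimes>\<^bsub>A\<^esub> P u v)"
    if "r \<in> carrier R" "v \<in> carrier A" for r v
    using a u that smult_assoc2[of r "P u v" a] by (simp add: P_smult_right m_comm)
  then show ?thesis
    using a u by (auto simp: derivations_def linear_maps_def P_add_right P_mult_right
        r_distr m_ac a_ac)
qed

lemma d_minus: "u \<in> carrier A \<Longrightarrow> d (\<ominus>\<^bsub>A\<^esub> u) = \<ominus>\<^bsub>D\<^esub> d u"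
proof -
  assume u: "u \<in> carrier A"
  interpret d: abelian_group_hom A D d
    by (rule abelian_group_hom_of_additive)
      (simp_all add: abelian_group_axioms D.abelian_group_axioms d_add)
  show ?thesis using u by simp
qed

lemma kaehler_poisson_formD:
  assumes "kaehler_poisson_form R A P form"
  shows "form \<in> carrier D \<rightarrow>\<^sub>E (carrier D \<rightarrow>\<^sub>E carrier A)"
    and "\<lbrakk>x \<in> carrier D; y \<in> carrier D\<rbrakk> \<Longrightarrow> form x y \<in> carrier A"
    and "\<lbrakk>x \<in> carrier D; x' \<in> carrier D; y \<in> carrier D\<rbrakk> \<Longrightarrow>
      form (x \<oplus>\<^bsub>D\<^esub> x') y = form x y \<oplus>\<^bsub>A\<^esub> form x' y"
    and "\<lbrakk>x \<in> carrier D; y \<in> carrier D; y' \<in> carrier D\<rbrakk> \<Longrightarrow>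
      form x (y \<oplus>\<^bsub>D\<^esub> y') = form x y \<oplus>\<^bsub>A\<^esub> form x y'"
    and "\<lbrakk>a \<in> carrier A; x \<in> carrier D; y \<in> carrier D\<rbrakk> \<Longrightarrow> form (a \<odot>\<^bsub>D\<^esub> x) y = a \<otimes>\<^bsub>A\<^esub> form x y"
    and "\<lbrakk>a \<in> carrier A; x \<in> carrier D; y \<in> carrier D\<rbrakk> \<Longrightarrow> form x (a \<odot>\<^bsub>D\<^esub> y) = a \<otimes>\<^bsub>A\<^esub> form x y"
    and "\<lbrakk>a \<in> carrier A; u \<in> carrier A; b \<in> carrier A; v \<in> carrier A\<rbrakk> \<Longrightarrow>
      form (a \<odot>\<^bsub>D\<^esub> d u) (b \<odot>\<^bsub>D\<^esub> d v) = a \<otimes>\<^bsub>A\<^esub> b \<otimes>\<^bsub>A\<^esub> P u v"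
  using assms unfolding kaehler_poisson_form_def Let_def linear_maps_def by auto

lemma kaehler_bracketD:
  assumes "kaehler_bracket R A P br"
  shows "br \<in> carrier D \<rightarrow>\<^sub>E (carrier D \<rightarrow>\<^sub>E carrier D)"
    and "\<lbrakk>x \<in> carrier D; y \<in> carrier D\<rbrakk> \<Longrightarrow> br x y \<in> carrier D"
    and "\<lbrakk>x \<in> carrier D; x' \<in> carrier D; y \<in> carrier D\<rbrakk> \<Longrightarrow>
      br (x \<oplus>\<^bsub>D\<^esub> x') y = br x y \<oplus>\<^bsub>D\<^esub> br x' y"
    and "\<lbrakk>x \<in> carrier D; y \<in> carrier D; y' \<in> carrier D\<rbrakk> \<Longrightarrow>
      br x (y \<oplus>\<^bsub>D\<^esub> y') = br x y \<oplus>\<^bsub>D\<^esub> br x y'"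
    and "\<lbrakk>r \<in> carrier R; x \<in> carrier D; y \<in> carrier D\<rbrakk> \<Longrightarrow>
      br ((r \<odot>\<^bsub>A\<^esub> \<one>\<^bsub>A\<^esub>) \<odot>\<^bsub>D\<^esub> x) y = (r \<odot>\<^bsub>A\<^esub> \<one>\<^bsub>A\<^esub>) \<odot>\<^bsub>D\<^esub> br x y"
    and "\<lbrakk>r \<in> carrier R; x \<in> carrier D; y \<in> carrier D\<rbrakk> \<Longrightarrow>
      br x ((r \<odot>\<^bsub>A\<^esub> \<one>\<^bsub>A\<^esub>) \<odot>\<^bsub>D\<^esub> y) = (r \<odot>\<^bsub>A\<^esub> \<one>\<^bsub>A\<^esub>) \<odot>\<^bsub>D\<^esub> br x y"
    and "\<lbrakk>a \<in> carrier A; u \<in> carrier A; b \<in> carrier A; v \<in> carrier A\<rbrakk> \<Longrightarrow>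
      br (a \<odot>\<^bsub>D\<^esub> d u) (b \<odot>\<^bsub>D\<^esub> d v) = (a \<otimes>\<^bsub>A\<^esub> P u b) \<odot>\<^bsub>D\<^esub> d v
        \<oplus>\<^bsub>D\<^esub> (b \<otimes>\<^bsub>A\<^esub> P a v) \<odot>\<^bsub>D\<^esub> d u \<oplus>\<^bsub>D\<^esub> (a \<otimes>\<^bsub>A\<^esub> b) \<odot>\<^bsub>D\<^esub> d (P u v)"
  using assms unfolding kaehler_bracket_def Let_def linear_maps_def restrict_scalars_def by auto

lemma kaehler_poisson_form_biadditive: "kaehler_poisson_form R A P form \<Longrightarrow> biadditive A form"
  unfolding biadditive_def by (simp add: kaehler_poisson_formD)

lemma kaehler_bracket_biadditive: "kaehler_bracket R A P br \<Longrightarrow> biadditive D br"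
  unfolding biadditive_def by (simp add: kaehler_bracketD)

lemma extensional_biadditive_eqI:
  assumes B: "biadditive M B" "B \<in> carrier D \<rightarrow>\<^sub>E (carrier D \<rightarrow>\<^sub>E carrier M)"
    and B': "biadditive M B'" "B' \<in> carrier D \<rightarrow>\<^sub>E (carrier D \<rightarrow>\<^sub>E carrier M)"
    and gen: "\<And>a u b v. \<lbrakk>a \<in> carrier A; u \<in> carrier A; b \<in> carrier A; v \<in> carrier A\<rbrakk> \<Longrightarrow>
      B (a \<odot>\<^bsub>D\<^esub> d u) (b \<odot>\<^bsub>D\<^esub> d v) = B' (a \<odot>\<^bsub>D\<^esub> d u) (b \<odot>\<^bsub>D\<^esub> d v)"
  shows "B = B'"
proof (rule PiE_ext[OF B(2) B'(2)])
  fix x assume x: "x \<in> carrier D"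
  show "B x = B' x"
    by (rule PiE_ext[OF PiE_mem[OF B(2) x] PiE_mem[OF B'(2) x]])
      (rule biadditive_eqI[OF B(1) B'(1) gen x])
qed

lemma kaehler_poisson_form_unique:
  assumes "kaehler_poisson_form R A P form" and "kaehler_poisson_form R A P form'"
  shows "form = form'"
  by (rule extensional_biadditive_eqI[where M = A])
    (simp_all add: assms[THEN kaehler_poisson_formD(1)] assms[THEN kaehler_poisson_formD(7)]
      assms[THEN kaehler_poisson_form_biadditive])

lemma kaehler_bracket_unique:
  assumes "kaehler_bracket R A P br" and "kaehler_bracket R A P br'"
  shows "br = br'"
  by (rule extensional_biadditive_eqI[where M = D])
    (simp_all add: assms[THEN kaehler_bracketD(1)] assms[THEN kaehler_bracketD(7)]
      assms[THEN kaehler_bracket_biadditive])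

text \<open>
  The functional \<open>\<pi>(du, -)\<close> on \<open>D\<close>, obtained from the derivation \<open>{u, -}\<close> by the universal property.
\<close>

lemma hamiltonian_functional:
  assumes u: "u \<in> carrier A"
  obtains \<phi> where "abelian_group_hom D A \<phi>"
    and "\<And>b y. \<lbrakk>b \<in> carrier A; y \<in> carrier D\<rbrakk> \<Longrightarrow> \<phi> (b \<odot>\<^bsub>D\<^esub> y) = b \<otimes>\<^bsub>A\<^esub> \<phi> y"
    and "\<And>v. v \<in> carrier A \<Longrightarrow> \<phi> (d v) = P u v"
proof -
  have zero: "(\<lambda>v\<in>carrier A. \<zero>\<^bsub>A\<^esub>) \<in> derivations R A"
    by (auto simp: derivations_def linear_maps_def)
  note S = self_module_is_module[THEN module.axioms(2)]
  obtain \<phi> where hom: "abelian_group_hom D (self_module A) \<phi>"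
    and \<phi>: "\<And>b y. \<lbrakk>b \<in> carrier A; y \<in> carrier D\<rbrakk> \<Longrightarrow> \<phi> (b \<odot>\<^bsub>D\<^esub> y) = b \<odot>\<^bsub>self_module A\<^esub> \<phi> y
        \<oplus>\<^bsub>self_module A\<^esub> (\<lambda>v\<in>carrier A. \<zero>\<^bsub>A\<^esub>) b \<odot>\<^bsub>self_module A\<^esub> \<zero>\<^bsub>A\<^esub>"
    "\<And>v. v \<in> carrier A \<Longrightarrow> \<phi> (d v) = P u v"
  proof (rule twisted_extension[OF self_module_is_module zero, where j = "\<lambda>_. \<zero>\<^bsub>A\<^esub>" and g = "P u"])
    show "abelian_group_hom D (self_module A) (\<lambda>_. \<zero>\<^bsub>A\<^esub>)"
      by (rule abelian_group_hom_of_additive) (simp_all add: D.abelian_group_axioms S)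
  next
    fix r v assume "r \<in> carrier R" "v \<in> carrier A"
    then show "P u (r \<odot>\<^bsub>A\<^esub> v) = (r \<odot>\<^bsub>A\<^esub> \<one>\<^bsub>A\<^esub>) \<odot>\<^bsub>self_module A\<^esub> P u v"
      using u by (simp add: P_smult_right scalar_mult)
  qed (use u in \<open>simp_all add: P_add_right P_mult_right\<close>)
  interpret \<phi>: abelian_group_hom D "self_module A" \<phi> by (rule hom)
  show thesis
  proof (rule that)
    show "abelian_group_hom D A \<phi>"
      by (rule abelian_group_hom_of_additive)
        (use \<phi>.hom_closed \<phi>.hom_add in \<open>simp_all add: D.abelian_group_axioms abelian_group_axioms\<close>)
  next
    fix b y assume "b \<in> carrier A" "y \<in> carrier D"
    then show "\<phi> (b \<odot>\<^bsub>D\<^esub> y) = b \<otimes>\<^bsub>A\<^esub> \<phi> y"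
      using \<phi>.hom_closed[of y] by (simp add: \<phi>(1))
  qed (simp add: \<phi>(2))
qed

lemma kaehler_poisson_form_exists: "\<exists>form. kaehler_poisson_form R A P form"
proof -
  let ?is_functional = "\<lambda>u \<phi>. abelian_group_hom D A \<phi> \<and>
    (\<forall>b\<in>carrier A. \<forall>y\<in>carrier D. \<phi> (b \<odot>\<^bsub>D\<^esub> y) = b \<otimes>\<^bsub>A\<^esub> \<phi> y) \<and>
    (\<forall>v\<in>carrier A. \<phi> (d v) = P u v)"
  have "\<forall>u\<in>carrier A. \<exists>\<phi>. ?is_functional u \<phi>"
    using hamiltonian_functional by metis
  from bchoice[OF this] obtain \<phi> where functional: "\<forall>u\<in>carrier A. ?is_functional u (\<phi> u)"
    by blast
  have hom: "abelian_group_hom D A (\<phi> u)" if "u \<in> carrier A" for u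
    using functional that by blast
  have \<phi>: "\<lbrakk>u \<in> carrier A; b \<in> carrier A; y \<in> carrier D\<rbrakk> \<Longrightarrow> \<phi> u (b \<odot>\<^bsub>D\<^esub> y) = b \<otimes>\<^bsub>A\<^esub> \<phi> u y"
    "\<lbrakk>u \<in> carrier A; v \<in> carrier A\<rbrakk> \<Longrightarrow> \<phi> u (d v) = P u v" for u b y v
    using functional by auto
  note hom_simps = abelian_group_hom.hom_closed[OF hom] abelian_group_hom.hom_add[OF hom]
  obtain B where B: "biadditive A B" and ext: "B \<in> carrier D \<rightarrow>\<^sub>E (carrier D \<rightarrow>\<^sub>E carrier A)"
    and B_gen: "\<And>a u y. \<lbrakk>a \<in> carrier A; u \<in> carrier A; y \<in> carrier D\<rbrakk> \<Longrightarrow>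
      B (a \<odot>\<^bsub>D\<^esub> d u) y = a \<otimes>\<^bsub>A\<^esub> \<phi> u y"
  proof (rule biadditive_extension[OF abelian_group_axioms, where \<Phi> = "\<lambda>a u y. a \<otimes>\<^bsub>A\<^esub> \<phi> u y"])
    fix a u assume "a \<in> carrier A" "u \<in> carrier A"
    then show "abelian_group_hom D A (\<lambda>y. a \<otimes>\<^bsub>A\<^esub> \<phi> u y)"
      by (intro abelian_group_hom_of_additive)
        (simp_all add: D.abelian_group_axioms abelian_group_axioms hom_simps r_distr)
  next
    fix a u b v assume "a \<in> carrier A" "u \<in> carrier A" "b \<in> carrier A" "v \<in> carrier A"
    then show "a \<otimes>\<^bsub>A\<^esub> \<phi> u (b \<odot>\<^bsub>D\<^esub> d v) = \<ominus>\<^bsub>A\<^esub> (b \<otimes>\<^bsub>A\<^esub> \<phi> v (a \<odot>\<^bsub>D\<^esub> d u))"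
      using P_antisym[of u v] by (simp add: \<phi> r_minus m_lcomm)
  qed blast
  have gen: "B (a \<odot>\<^bsub>D\<^esub> d u) (b \<odot>\<^bsub>D\<^esub> d v) = a \<otimes>\<^bsub>A\<^esub> b \<otimes>\<^bsub>A\<^esub> P u v"
    if "a \<in> carrier A" "u \<in> carrier A" "b \<in> carrier A" "v \<in> carrier A" for a u b v
    using that by (simp add: B_gen \<phi> m_assoc)
  have gen_antisym: "B (a \<odot>\<^bsub>D\<^esub> d u) (b \<odot>\<^bsub>D\<^esub> d v) = \<ominus>\<^bsub>A\<^esub> B (b \<odot>\<^bsub>D\<^esub> d v) (a \<odot>\<^bsub>D\<^esub> d u)"
    if "a \<in> carrier A" "u \<in> carrier A" "b \<in> carrier A" "v \<in> carrier A" for a u b v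
    using that P_antisym[of u v] by (simp add: gen r_minus m_comm)
  have smult_right: "B x (c \<odot>\<^bsub>D\<^esub> y) = c \<otimes>\<^bsub>A\<^esub> B x y"
    if x: "x \<in> carrier D" and c: "c \<in> carrier A" and y: "y \<in> carrier D" for c x y
    using x
  proof (induction rule: kaehler_induct)
    case (gen a u)
    then show ?case using c y by (simp add: B_gen \<phi> hom_simps m_lcomm)
  next
    case (add x x')
    then show ?case using c y by (simp add: biadditiveD[OF B] r_distr)
  qed
  have antisym: "B x y = \<ominus>\<^bsub>A\<^esub> B y x" if "x \<in> carrier D" "y \<in> carrier D" for x y
    by (rule biadditive_antisym[OF abelian_group_axioms B gen_antisym that])
  have smult_left: "B (c \<odot>\<^bsub>D\<^esub> x) y = c \<otimes>\<^bsub>A\<^esub> B x y"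
    if x: "x \<in> carrier D" and c: "c \<in> carrier A" and y: "y \<in> carrier D" for c x y
    using x c y antisym[of "c \<odot>\<^bsub>D\<^esub> x" y] antisym[of x y]
    by (simp add: smult_right biadditiveD[OF B] r_minus)
  have alternating: "B x x = \<zero>\<^bsub>A\<^esub>" if "x \<in> carrier D" for x
    by (rule biadditive_alternating[OF abelian_group_axioms B gen_antisym _ that])
      (auto simp: gen poisson.lie.bracket_self)
  have "B (d u) (d v) = P u v" if "u \<in> carrier A" "v \<in> carrier A" for u v
    using gen[of "\<one>\<^bsub>A\<^esub>" u "\<one>\<^bsub>A\<^esub>" v] that by simp
  then have "kaehler_poisson_form R A P B"
    unfolding kaehler_poisson_form_def Let_def linear_maps_def
    using ext by (auto simp: biadditiveD[OF B] smult_left smult_right alternating m_ac)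
  then show ?thesis by blast
qed

text \<open>
  The operator \<open>[a du, -]\<close>. The Lie derivative along \<open>a {u, -}\<close> would send \<open>dv\<close> to
  \<open>d (a {u, v}) = {u, v} da + a d{u, v}\<close>; the bracket subtracts from it the contraction of
  \<open>da \<and> du\<close> with \<open>{v, -}\<close>, which trades \<open>{u, v} da\<close> for \<open>{a, v} du\<close>.
\<close>

lemma bracket_with_generator:
  assumes a: "a \<in> carrier A" and u: "u \<in> carrier A"
  obtains L where "abelian_group_hom D D L"
    and "\<And>b y. \<lbrakk>b \<in> carrier A; y \<in> carrier D\<rbrakk> \<Longrightarrow>
      L (b \<odot>\<^bsub>D\<^esub> y) = b \<odot>\<^bsub>D\<^esub> L y \<oplus>\<^bsub>D\<^esub> (a \<otimes>\<^bsub>A\<^esub> P u b) \<odot>\<^bsub>D\<^esub> y"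
    and "\<And>v. v \<in> carrier A \<Longrightarrow> L (d v) = P a v \<odot>\<^bsub>D\<^esub> d u \<oplus>\<^bsub>D\<^esub> a \<odot>\<^bsub>D\<^esub> d (P u v)"
proof -
  note closed = a u
  obtain L where hom: "abelian_group_hom D D L"
    and L: "\<And>b y. \<lbrakk>b \<in> carrier A; y \<in> carrier D\<rbrakk> \<Longrightarrow>
      L (b \<odot>\<^bsub>D\<^esub> y) = b \<odot>\<^bsub>D\<^esub> L y \<oplus>\<^bsub>D\<^esub> (\<lambda>v\<in>carrier A. a \<otimes>\<^bsub>A\<^esub> P u v) b \<odot>\<^bsub>D\<^esub> y"
    "\<And>v. v \<in> carrier A \<Longrightarrow> L (d v) = P a v \<odot>\<^bsub>D\<^esub> d u \<oplus>\<^bsub>D\<^esub> a \<odot>\<^bsub>D\<^esub> d (P u v)"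
  proof (rule twisted_extension[OF D.module_axioms hamiltonian_derivation[OF a u], where j = "\<lambda>x. x"
        and g = "\<lambda>v. P a v \<odot>\<^bsub>D\<^esub> d u \<oplus>\<^bsub>D\<^esub> a \<odot>\<^bsub>D\<^esub> d (P u v)"])
    show "abelian_group_hom D D (\<lambda>x. x)"
      by (rule abelian_group_hom_of_additive) (simp_all add: D.abelian_group_axioms)
  next
    fix v w assume "v \<in> carrier A" "w \<in> carrier A"
    then show "P a (v \<oplus>\<^bsub>A\<^esub> w) \<odot>\<^bsub>D\<^esub> d u \<oplus>\<^bsub>D\<^esub> a \<odot>\<^bsub>D\<^esub> d (P u (v \<oplus>\<^bsub>A\<^esub> w)) =
        P a v \<odot>\<^bsub>D\<^esub> d u \<oplus>\<^bsub>D\<^esub> a \<odot>\<^bsub>D\<^esub> d (P u v) \<oplus>\<^bsub>D\<^esub> (P a w \<odot>\<^bsub>D\<^esub> d u \<oplus>\<^bsub>D\<^esub> a \<odot>\<^bsub>D\<^esub> d (P u w))"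
      using closed by (simp add: P_add_right d_add D.smult_l_distr D.smult_r_distr D.M.a_ac)
  next
    fix r v assume rv: "r \<in> carrier R" "v \<in> carrier A"
    have "P a (r \<odot>\<^bsub>A\<^esub> v) = (r \<odot>\<^bsub>A\<^esub> \<one>\<^bsub>A\<^esub>) \<otimes>\<^bsub>A\<^esub> P a v"
      using rv closed by (simp add: P_smult_right scalar_mult)
    moreover have "d (P u (r \<odot>\<^bsub>A\<^esub> v)) = (r \<odot>\<^bsub>A\<^esub> \<one>\<^bsub>A\<^esub>) \<odot>\<^bsub>D\<^esub> d (P u v)"
      using rv closed by (simp add: P_smult_right d_smult)
    ultimately show "P a (r \<odot>\<^bsub>A\<^esub> v) \<odot>\<^bsub>D\<^esub> d u \<oplus>\<^bsub>D\<^esub> a \<odot>\<^bsub>D\<^esub> d (P u (r \<odot>\<^bsub>A\<^esub> v)) =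
        (r \<odot>\<^bsub>A\<^esub> \<one>\<^bsub>A\<^esub>) \<odot>\<^bsub>D\<^esub> (P a v \<odot>\<^bsub>D\<^esub> d u \<oplus>\<^bsub>D\<^esub> a \<odot>\<^bsub>D\<^esub> d (P u v))"
      using rv closed by (simp add: D.smult_r_distr m_comm flip: D.smult_assoc1)
  next
    fix v w assume "v \<in> carrier A" "w \<in> carrier A"
    then show "P a (v \<otimes>\<^bsub>A\<^esub> w) \<odot>\<^bsub>D\<^esub> d u \<oplus>\<^bsub>D\<^esub> a \<odot>\<^bsub>D\<^esub> d (P u (v \<otimes>\<^bsub>A\<^esub> w)) =
        w \<odot>\<^bsub>D\<^esub> (P a v \<odot>\<^bsub>D\<^esub> d u \<oplus>\<^bsub>D\<^esub> a \<odot>\<^bsub>D\<^esub> d (P u v)) \<oplus>\<^bsub>D\<^esub>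
        v \<odot>\<^bsub>D\<^esub> (P a w \<odot>\<^bsub>D\<^esub> d u \<oplus>\<^bsub>D\<^esub> a \<odot>\<^bsub>D\<^esub> d (P u w)) \<oplus>\<^bsub>D\<^esub>
        ((\<lambda>v\<in>carrier A. a \<otimes>\<^bsub>A\<^esub> P u v) w \<odot>\<^bsub>D\<^esub> d v \<oplus>\<^bsub>D\<^esub>
         (\<lambda>v\<in>carrier A. a \<otimes>\<^bsub>A\<^esub> P u v) v \<odot>\<^bsub>D\<^esub> d w)"
      using closed by (simp add: P_mult_right d_add d_mult D.smult_l_distr D.smult_r_distr
          D.M.a_ac m_ac flip: D.smult_assoc1)
  qed (use closed in simp_all)
  show thesis by (rule that[OF hom]) (simp_all add: L)
qed

text \<open>
  The first two summands are exchanged by swapping \<open>(a, u)\<close> and \<open>(b, v)\<close>, and the signs come from the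
  antisymmetry of \<open>P\<close>.
\<close>

lemma bracket_formula_antisym:
  assumes "a \<in> carrier A" and "u \<in> carrier A" and "b \<in> carrier A" and "v \<in> carrier A"
  shows "(a \<otimes>\<^bsub>A\<^esub> P u b) \<odot>\<^bsub>D\<^esub> d v \<oplus>\<^bsub>D\<^esub> (b \<otimes>\<^bsub>A\<^esub> P a v) \<odot>\<^bsub>D\<^esub> d u
      \<oplus>\<^bsub>D\<^esub> (a \<otimes>\<^bsub>A\<^esub> b) \<odot>\<^bsub>D\<^esub> d (P u v) =
    \<ominus>\<^bsub>D\<^esub> ((b \<otimes>\<^bsub>A\<^esub> P v a) \<odot>\<^bsub>D\<^esub> d u \<oplus>\<^bsub>D\<^esub> (a \<otimes>\<^bsub>A\<^esub> P b u) \<odot>\<^bsub>D\<^esub> d v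
      \<oplus>\<^bsub>D\<^esub> (b \<otimes>\<^bsub>A\<^esub> a) \<odot>\<^bsub>D\<^esub> d (P v u))"
  using assms P_antisym[of u v] P_antisym[of u b] P_antisym[of a v]
  by (simp add: d_minus D.smult_l_minus D.smult_r_minus r_minus D.M.minus_add D.M.a_ac m_comm)

lemma kaehler_bracket_exists: "\<exists>br. kaehler_bracket R A P br"
proof -
  let ?is_operator = "\<lambda>a u L. abelian_group_hom D D L \<and>
    (\<forall>b\<in>carrier A. \<forall>y\<in>carrier D. L (b \<odot>\<^bsub>D\<^esub> y) = b \<odot>\<^bsub>D\<^esub> L y \<oplus>\<^bsub>D\<^esub> (a \<otimes>\<^bsub>A\<^esub> P u b) \<odot>\<^bsub>D\<^esub> y) \<and>
    (\<forall>v\<in>carrier A. L (d v) = P a v \<odot>\<^bsub>D\<^esub> d u \<oplus>\<^bsub>D\<^esub> a \<odot>\<^bsub>D\<^esub> d (P u v))"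
  have "\<exists>L. ?is_operator a u L" if au: "a \<in> carrier A" "u \<in> carrier A" for a u
    using bracket_with_generator[OF au] by (metis (no_types, lifting))
  then have "\<forall>a\<in>carrier A. \<exists>f. \<forall>u\<in>carrier A. ?is_operator a u (f u)"
    by (intro ballI bchoice)
  from bchoice[OF this] obtain L
    where operators: "\<forall>a\<in>carrier A. \<forall>u\<in>carrier A. ?is_operator a u (L a u)"
    by blast
  have hom: "abelian_group_hom D D (L a u)" if "a \<in> carrier A" "u \<in> carrier A" for a u
    using operators that by blast
  have L: "\<lbrakk>a \<in> carrier A; u \<in> carrier A; b \<in> carrier A; y \<in> carrier D\<rbrakk> \<Longrightarrow>
      L a u (b \<odot>\<^bsub>D\<^esub> y) = b \<odot>\<^bsub>D\<^esub> L a u y \<oplus>\<^bsub>D\<^esub> (a \<otimes>\<^bsub>A\<^esub> P u b) \<odot>\<^bsub>D\<^esub> y"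
    "\<lbrakk>a \<in> carrier A; u \<in> carrier A; v \<in> carrier A\<rbrakk> \<Longrightarrow>
      L a u (d v) = P a v \<odot>\<^bsub>D\<^esub> d u \<oplus>\<^bsub>D\<^esub> a \<odot>\<^bsub>D\<^esub> d (P u v)" for a u b y v
    using operators by auto
  note hom_simps = abelian_group_hom.hom_closed[OF hom]
  have L_gen: "L a u (b \<odot>\<^bsub>D\<^esub> d v) = (a \<otimes>\<^bsub>A\<^esub> P u b) \<odot>\<^bsub>D\<^esub> d v \<oplus>\<^bsub>D\<^esub> (b \<otimes>\<^bsub>A\<^esub> P a v) \<odot>\<^bsub>D\<^esub> d u
      \<oplus>\<^bsub>D\<^esub> (a \<otimes>\<^bsub>A\<^esub> b) \<odot>\<^bsub>D\<^esub> d (P u v)"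
    if "a \<in> carrier A" "u \<in> carrier A" "b \<in> carrier A" "v \<in> carrier A" for a u b v
    using that by (simp add: L D.smult_r_distr D.M.a_ac m_comm flip: D.smult_assoc1)
  have L_antisym: "L a u (b \<odot>\<^bsub>D\<^esub> d v) = \<ominus>\<^bsub>D\<^esub> L b v (a \<odot>\<^bsub>D\<^esub> d u)"
    if "a \<in> carrier A" "u \<in> carrier A" "b \<in> carrier A" "v \<in> carrier A" for a u b v
    using that by (simp only: L_gen bracket_formula_antisym[of a u b v])
  obtain B where B: "biadditive D B" and ext: "B \<in> carrier D \<rightarrow>\<^sub>E (carrier D \<rightarrow>\<^sub>E carrier D)"
    and B_gen: "\<And>a u y. \<lbrakk>a \<in> carrier A; u \<in> carrier A; y \<in> carrier D\<rbrakk> \<Longrightarrow>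
      B (a \<odot>\<^bsub>D\<^esub> d u) y = L a u y"
    by (rule biadditive_extension[OF D.abelian_group_axioms, where \<Phi> = L])
      (assumption | rule hom L_antisym that)+
  have smult_right: "B x ((r \<odot>\<^bsub>A\<^esub> \<one>\<^bsub>A\<^esub>) \<odot>\<^bsub>D\<^esub> y) = (r \<odot>\<^bsub>A\<^esub> \<one>\<^bsub>A\<^esub>) \<odot>\<^bsub>D\<^esub> B x y"
    if x: "x \<in> carrier D" and r: "r \<in> carrier R" and y: "y \<in> carrier D" for r x y
    using x
  proof (induction rule: kaehler_induct)
    case (gen a u)
    \<comment> \<open>a derivation kills scalars, so the correction term of the Leibniz rule disappears\<close>
    have "a \<otimes>\<^bsub>A\<^esub> P u (r \<odot>\<^bsub>A\<^esub> \<one>\<^bsub>A\<^esub>) = \<zero>\<^bsub>A\<^esub>"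
      using derivation_scalar[OF hamiltonian_derivation[OF gen] r] r by simp
    then show ?case using gen r y by (simp add: B_gen L hom_simps)
  next
    case (add x x')
    then show ?case using r y by (simp add: biadditiveD[OF B] D.smult_r_distr)
  qed
  have antisym: "B x y = \<ominus>\<^bsub>D\<^esub> B y x" if "x \<in> carrier D" "y \<in> carrier D" for x y
  proof (rule biadditive_antisym[OF D.abelian_group_axioms B _ that])
    fix a u b v assume "a \<in> carrier A" "u \<in> carrier A" "b \<in> carrier A" "v \<in> carrier A"
    then show "B (a \<odot>\<^bsub>D\<^esub> d u) (b \<odot>\<^bsub>D\<^esub> d v) = \<ominus>\<^bsub>D\<^esub> B (b \<odot>\<^bsub>D\<^esub> d v) (a \<odot>\<^bsub>D\<^esub> d u)"
      using L_antisym[of a u b v] by (simp only: B_gen D.smult_closed d_closed)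
  qed
  have smult_left: "B ((r \<odot>\<^bsub>A\<^esub> \<one>\<^bsub>A\<^esub>) \<odot>\<^bsub>D\<^esub> x) y = (r \<odot>\<^bsub>A\<^esub> \<one>\<^bsub>A\<^esub>) \<odot>\<^bsub>D\<^esub> B x y"
    if x: "x \<in> carrier D" and r: "r \<in> carrier R" and y: "y \<in> carrier D" for r x y
  proof -
    have "B ((r \<odot>\<^bsub>A\<^esub> \<one>\<^bsub>A\<^esub>) \<odot>\<^bsub>D\<^esub> x) y = \<ominus>\<^bsub>D\<^esub> B y ((r \<odot>\<^bsub>A\<^esub> \<one>\<^bsub>A\<^esub>) \<odot>\<^bsub>D\<^esub> x)"
      by (rule antisym) (use x r y in simp_all)
    also have "\<dots> = (r \<odot>\<^bsub>A\<^esub> \<one>\<^bsub>A\<^esub>) \<odot>\<^bsub>D\<^esub> (\<ominus>\<^bsub>D\<^esub> B y x)"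
      using x r y by (simp add: smult_right biadditiveD(1)[OF B] D.smult_r_minus)
    finally show ?thesis by (simp only: antisym[OF x y])
  qed
  have "kaehler_bracket R A P B"
    unfolding kaehler_bracket_def Let_def linear_maps_def restrict_scalars_def
    using ext by (auto simp: biadditiveD[OF B] smult_left smult_right B_gen L_gen)
  then show ?thesis by blast
qed

end

section \<open>Derivations form a Lie algebra over the pair\<close>

lemma restrict_scalars_simps [simp]:
  "carrier (restrict_scalars R A L) = carrier L"
  "\<zero>\<^bsub>restrict_scalars R A L\<^esub> = \<zero>\<^bsub>L\<^esub>"
  "x \<oplus>\<^bsub>restrict_scalars R A L\<^esub> y = x \<oplus>\<^bsub>L\<^esub> y"
  "r \<odot>\<^bsub>restrict_scalars R A L\<^esub> x = (r \<odot>\<^bsub>A\<^esub> \<one>\<^bsub>A\<^esub>) \<odot>\<^bsub>L\<^esub> x"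
  by (simp_all add: restrict_scalars_def)

lemma Der_simps:
  "carrier (Der R A) = derivations R A"
  "\<zero>\<^bsub>Der R A\<^esub> = (\<lambda>x\<in>carrier A. \<zero>\<^bsub>A\<^esub>)"
  "f \<oplus>\<^bsub>Der R A\<^esub> g = (\<lambda>x\<in>carrier A. f x \<oplus>\<^bsub>A\<^esub> g x)"
  "a \<odot>\<^bsub>Der R A\<^esub> f = (\<lambda>x\<in>carrier A. a \<otimes>\<^bsub>A\<^esub> f x)"
  by (simp_all add: Der_def)

text \<open>
  The letters stand for the six orders in which three derivations can be composed: this is the
  Jacobi identity for commutators, stripped of the derivations.
\<close>

lemma (in abelian_group) jacobi_cancellation:
  assumes "a \<in> carrier G" "b \<in> carrier G" "c \<in> carrier G" "e \<in> carrier G" "p \<in> carrier G" "q \<in> carrier G"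
  shows "((a \<ominus> b) \<ominus> (c \<ominus> e)) \<oplus> ((c \<ominus> p) \<ominus> (q \<ominus> b)) \<oplus> ((q \<ominus> e) \<ominus> (a \<ominus> p)) = \<zero>"
proof -
  have "((a \<ominus> b) \<ominus> (c \<ominus> e)) \<oplus> ((c \<ominus> p) \<ominus> (q \<ominus> b)) \<oplus> ((q \<ominus> e) \<ominus> (a \<ominus> p)) =
    (a \<oplus> \<ominus> a) \<oplus> (b \<oplus> \<ominus> b) \<oplus> (c \<oplus> \<ominus> c) \<oplus> (e \<oplus> \<ominus> e) \<oplus> (p \<oplus> \<ominus> p) \<oplus> (q \<oplus> \<ominus> q)"
    using assms by (simp add: minus_eq minus_add a_ac)
  also have "\<dots> = \<zero>" using assms by (simp add: r_neg)
  finally show ?thesis .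
qed

text \<open>
  In \<open>[f, g](x y)\<close> the mixed terms \<open>q = g x \<cdot> f y\<close> and \<open>s = f x \<cdot> g y\<close> occur with both signs.
\<close>

lemma (in abelian_group) leibniz_cancellation:
  assumes "p \<in> carrier G" "p' \<in> carrier G" "q \<in> carrier G" "s \<in> carrier G" "t \<in> carrier G" "t' \<in> carrier G"
  shows "((p \<oplus> q) \<oplus> (s \<oplus> t)) \<ominus> ((p' \<oplus> s) \<oplus> (q \<oplus> t')) = (p \<ominus> p') \<oplus> (t \<ominus> t')"
proof -
  have "((p \<oplus> q) \<oplus> (s \<oplus> t)) \<ominus> ((p' \<oplus> s) \<oplus> (q \<oplus> t')) =
    (p \<ominus> p') \<oplus> (t \<ominus> t') \<oplus> ((q \<oplus> \<ominus> q) \<oplus> (s \<oplus> \<ominus> s))"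
    using assms by (simp add: minus_eq minus_add a_ac)
  then show ?thesis using assms by (simp add: r_neg)
qed

context kaehler_differentials
begin

lemma restrict_scalars_module:
  assumes "module A L"
  shows "module R (restrict_scalars R A L)"
proof -
  interpret L: module A L by (rule assms)
  show ?thesis
  proof (rule moduleI)
    show "abelian_group (restrict_scalars R A L)"
      by (rule abelian_groupI)
        (auto simp: L.M.a_ac intro: bexI[of _ "\<ominus>\<^bsub>L\<^esub> x" for x] L.M.l_neg)
  next
    fix r s x assume rs: "r \<in> carrier R" "s \<in> carrier R" and x: "x \<in> carrier (restrict_scalars R A L)"
    have "(r \<otimes>\<^bsub>R\<^esub> s) \<odot>\<^bsub>A\<^esub> \<one>\<^bsub>A\<^esub> = (r \<odot>\<^bsub>A\<^esub> \<one>\<^bsub>A\<^esub>) \<otimes>\<^bsub>A\<^esub> (s \<odot>\<^bsub>A\<^esub> \<one>\<^bsub>A\<^esub>)"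
      using rs by (simp add: smult_assoc1 scalar_mult)
    then show "(r \<otimes>\<^bsub>R\<^esub> s) \<odot>\<^bsub>restrict_scalars R A L\<^esub> x =
        r \<odot>\<^bsub>restrict_scalars R A L\<^esub> (s \<odot>\<^bsub>restrict_scalars R A L\<^esub> x)"
      using rs x by (simp add: L.smult_assoc1)
  qed (auto simp: R_cring smult_l_distr L.smult_l_distr L.smult_r_distr)
qed

lemma derivation_minus:
  assumes f: "f \<in> derivations R A" and x: "x \<in> carrier A" and y: "y \<in> carrier A"
  shows "f (x \<ominus>\<^bsub>A\<^esub> y) = f x \<ominus>\<^bsub>A\<^esub> f y"
proof -
  interpret f: abelian_group_hom A A f
    by (rule abelian_group_hom_of_additive) (simp_all add: abelian_group_axioms derivationD[OF f])
  show ?thesis using x y by (simp add: minus_eq)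
qed

lemma derivation_scalar_mult:
  assumes f: "f \<in> derivations R A" and r: "r \<in> carrier R" and x: "x \<in> carrier A"
  shows "f ((r \<odot>\<^bsub>A\<^esub> \<one>\<^bsub>A\<^esub>) \<otimes>\<^bsub>A\<^esub> x) = (r \<odot>\<^bsub>A\<^esub> \<one>\<^bsub>A\<^esub>) \<otimes>\<^bsub>A\<^esub> f x"
  using f r x by (simp add: scalar_mult derivationD)

lemma derivationsI:
  assumes "f \<in> extensional (carrier A)"
    and "\<And>x. x \<in> carrier A \<Longrightarrow> f x \<in> carrier A"
    and "\<And>x y. \<lbrakk>x \<in> carrier A; y \<in> carrier A\<rbrakk> \<Longrightarrow> f (x \<oplus>\<^bsub>A\<^esub> y) = f x \<oplus>\<^bsub>A\<^esub> f y"
    and "\<And>x y. \<lbrakk>x \<in> carrier A; y \<in> carrier A\<rbrakk> \<Longrightarrow> f (x \<otimes>\<^bsub>A\<^esub> y) = f x \<otimes>\<^bsub>A\<^esub> y \<oplus>\<^bsub>A\<^esub> x \<otimes>\<^bsub>A\<^esub> f y"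
    and "\<And>r x. \<lbrakk>r \<in> carrier R; x \<in> carrier A\<rbrakk> \<Longrightarrow> f (r \<odot>\<^bsub>A\<^esub> x) = r \<odot>\<^bsub>A\<^esub> f x"
  shows "f \<in> derivations R A"
  using assms by (auto simp: derivations_def linear_maps_def PiE_def)

lemma mult_smult_right:
  "\<lbrakk>r \<in> carrier R; x \<in> carrier A; y \<in> carrier A\<rbrakk> \<Longrightarrow>
    x \<otimes>\<^bsub>A\<^esub> (r \<odot>\<^bsub>A\<^esub> y) = r \<odot>\<^bsub>A\<^esub> (x \<otimes>\<^bsub>A\<^esub> y)"
  using smult_assoc2[of r y x] by (simp add: m_comm)

lemma derivation_extensional: "f \<in> derivations R A \<Longrightarrow> f \<in> extensional (carrier A)"
  by (auto simp: derivations_def PiE_def)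

lemma derivation_eqI:
  assumes "f \<in> derivations R A" and "g \<in> derivations R A"
    and "\<And>x. x \<in> carrier A \<Longrightarrow> f x = g x"
  shows "f = g"
  using assms by (meson derivation_extensional extensionalityI)

lemma derivation_add:
  assumes f: "f \<in> derivations R A" and g: "g \<in> derivations R A"
  shows "(\<lambda>x\<in>carrier A. f x \<oplus>\<^bsub>A\<^esub> g x) \<in> derivations R A"
  by (rule derivationsI)
    (simp_all add: derivationD[OF f] derivationD[OF g] smult_r_distr l_distr r_distr a_ac)

lemma derivation_smult:
  assumes f: "f \<in> derivations R A" and a: "a \<in> carrier A"
  shows "(\<lambda>x\<in>carrier A. a \<otimes>\<^bsub>A\<^esub> f x) \<in> derivations R A"
  by (rule derivationsI)
    (simp_all add: a derivationD[OF f] mult_smult_right r_distr m_ac)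

lemma derivation_zero: "(\<lambda>x\<in>carrier A. \<zero>\<^bsub>A\<^esub>) \<in> derivations R A"
  by (rule derivationsI) simp_all

lemma commutator_derivation:
  assumes f: "f \<in> derivations R A" and g: "g \<in> derivations R A"
  shows "commutator A f g \<in> derivations R A"
proof (rule derivationsI)
  fix x y assume x: "x \<in> carrier A" and y: "y \<in> carrier A"
  show "commutator A f g (x \<otimes>\<^bsub>A\<^esub> y) =
      commutator A f g x \<otimes>\<^bsub>A\<^esub> y \<oplus>\<^bsub>A\<^esub> x \<otimes>\<^bsub>A\<^esub> commutator A f g y"
    using x y leibniz_cancellation[of "f (g x) \<otimes>\<^bsub>A\<^esub> y" "g (f x) \<otimes>\<^bsub>A\<^esub> y" "g x \<otimes>\<^bsub>A\<^esub> f y"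
        "f x \<otimes>\<^bsub>A\<^esub> g y" "x \<otimes>\<^bsub>A\<^esub> f (g y)" "x \<otimes>\<^bsub>A\<^esub> g (f y)"]
    by (simp add: commutator_def derivationD(1,2,3)[OF f] derivationD(1,2,3)[OF g]
        minus_eq l_distr r_distr l_minus r_minus)
qed (simp_all add: commutator_def derivationD(1,2,4)[OF f] derivationD(1,2,4)[OF g]
    smult_r_distr smult_r_minus minus_eq minus_add a_ac)

lemma Der_module: "module A (Der R A)"
proof (rule moduleI)
  show "abelian_group (Der R A)"
  proof (rule abelian_groupI)
    fix f assume "f \<in> carrier (Der R A)"
    then have f: "f \<in> derivations R A" by (simp add: Der_simps)
    show "\<exists>g\<in>carrier (Der R A). g \<oplus>\<^bsub>Der R A\<^esub> f = \<zero>\<^bsub>Der R A\<^esub>"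
    proof (rule bexI)
      \<comment> \<open>the negative is taken as multiplication by \<open>-1\<close>, so that closure under scalars applies\<close>
      show "(\<lambda>x\<in>carrier A. (\<ominus>\<^bsub>A\<^esub> \<one>\<^bsub>A\<^esub>) \<otimes>\<^bsub>A\<^esub> f x) \<in> carrier (Der R A)"
        using derivation_smult[OF f] by (simp add: Der_simps)
    qed (auto simp: Der_simps derivationD(1)[OF f] l_minus l_neg fun_eq_iff restrict_def)
  next
    fix f assume "f \<in> carrier (Der R A)"
    then show "\<zero>\<^bsub>Der R A\<^esub> \<oplus>\<^bsub>Der R A\<^esub> f = f"
      unfolding Der_simps
      by (intro derivation_eqI derivation_add derivation_zero) (simp_all add: derivationD(1))
  qed (auto simp: Der_simps derivation_add derivation_zero derivationD(1) a_ac intro!: restrict_ext)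
next
  fix f assume "f \<in> carrier (Der R A)"
  then show "\<one>\<^bsub>A\<^esub> \<odot>\<^bsub>Der R A\<^esub> f = f"
    by (intro derivation_eqI) (simp_all add: Der_simps derivation_smult derivationD(1))
qed (auto simp: Der_simps derivation_smult derivationD(1) is_cring l_distr r_distr m_assoc
      intro!: restrict_ext)

lemma Der_lie_algebra: "lie_algebra R (restrict_scalars R A (Der R A)) (commutator A)"
proof (intro lie_algebra.intro lie_algebra_axioms.intro restrict_scalars_module Der_module;
    simp only: restrict_scalars_simps Der_simps)
  fix f g h assume f: "f \<in> derivations R A" and g: "g \<in> derivations R A" and h: "h \<in> derivations R A"
  note D = derivationD(1,2,3)[OF f] derivationD(1,2,3)[OF g] derivationD(1,2,3)[OF h]
  show "commutator A (\<lambda>x\<in>carrier A. f x \<oplus>\<^bsub>A\<^esub> g x) h =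
      (\<lambda>x\<in>carrier A. commutator A f h x \<oplus>\<^bsub>A\<^esub> commutator A g h x)"
    unfolding commutator_def by (rule restrict_ext) (simp add: D minus_eq minus_add a_ac)
  show "commutator A f (\<lambda>x\<in>carrier A. g x \<oplus>\<^bsub>A\<^esub> h x) =
      (\<lambda>x\<in>carrier A. commutator A f g x \<oplus>\<^bsub>A\<^esub> commutator A f h x)"
    unfolding commutator_def by (rule restrict_ext) (simp add: D minus_eq minus_add a_ac)
  show "(\<lambda>x\<in>carrier A. (\<lambda>x\<in>carrier A. commutator A f (commutator A g h) x \<oplus>\<^bsub>A\<^esub>
      commutator A g (commutator A h f) x) x \<oplus>\<^bsub>A\<^esub> commutator A h (commutator A f g) x) =
      (\<lambda>x\<in>carrier A. \<zero>\<^bsub>A\<^esub>)"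
    unfolding commutator_def by (rule restrict_ext)
      (simp add: D derivation_minus f g h jacobi_cancellation)
next
  fix f g assume "f \<in> derivations R A" "g \<in> derivations R A"
  then show "commutator A f g \<in> derivations R A" by (rule commutator_derivation)
next
  fix r f g assume r: "r \<in> carrier R" and f: "f \<in> derivations R A" and g: "g \<in> derivations R A"
  show "commutator A (\<lambda>x\<in>carrier A. (r \<odot>\<^bsub>A\<^esub> \<one>\<^bsub>A\<^esub>) \<otimes>\<^bsub>A\<^esub> f x) g =
      (\<lambda>x\<in>carrier A. (r \<odot>\<^bsub>A\<^esub> \<one>\<^bsub>A\<^esub>) \<otimes>\<^bsub>A\<^esub> commutator A f g x)"
    unfolding commutator_def by (rule restrict_ext)
      (simp add: r derivationD(1)[OF f] derivationD(1)[OF g] derivation_scalar_mult[OF g] minus_eq r_distr r_minus)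
  show "commutator A f (\<lambda>x\<in>carrier A. (r \<odot>\<^bsub>A\<^esub> \<one>\<^bsub>A\<^esub>) \<otimes>\<^bsub>A\<^esub> g x) =
      (\<lambda>x\<in>carrier A. (r \<odot>\<^bsub>A\<^esub> \<one>\<^bsub>A\<^esub>) \<otimes>\<^bsub>A\<^esub> commutator A f g x)"
    unfolding commutator_def by (rule restrict_ext)
      (simp add: r derivationD(1)[OF f] derivationD(1)[OF g] derivation_scalar_mult[OF f] minus_eq r_distr r_minus)
next
  fix f assume f: "f \<in> derivations R A"
  show "commutator A f f = (\<lambda>x\<in>carrier A. \<zero>\<^bsub>A\<^esub>)"
    unfolding commutator_def by (rule restrict_ext) (simp add: derivationD(1)[OF f] minus_eq r_neg)
qed

lemma Der_ra_lie_algebra: "ra_lie_algebra R A (Der R A) (commutator A) id"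
proof (intro ra_lie_algebra.intro ra_lie_algebra_axioms.intro lie_algebra_hom.intro
    lie_algebra_hom_axioms.intro algebra_axioms Der_module Der_lie_algebra; (simp only: id_apply Der_simps)?)
  show "id \<in> linear_maps R (restrict_scalars R A (Der R A)) (restrict_scalars R A (Der R A))"
    by (auto simp: linear_maps_def)
next
  fix f a g assume f: "f \<in> derivations R A" and a: "a \<in> carrier A" and g: "g \<in> derivations R A"
  show "commutator A f (\<lambda>x\<in>carrier A. a \<otimes>\<^bsub>A\<^esub> g x) =
      (\<lambda>x\<in>carrier A. (\<lambda>x\<in>carrier A. a \<otimes>\<^bsub>A\<^esub> commutator A f g x) x \<oplus>\<^bsub>A\<^esub>
        (\<lambda>x\<in>carrier A. f a \<otimes>\<^bsub>A\<^esub> g x) x)"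
    unfolding commutator_def by (rule restrict_ext)
      (simp add: a derivationD(1,3)[OF f] derivationD(1)[OF g] minus_eq r_distr r_minus a_ac)
qed simp_all

end

section \<open>The Lie algebra structure on differentials\<close>

lemma (in abelian_group) sum_minus_minus_zero_iff:
  assumes "x \<in> carrier G" "y \<in> carrier G" "z \<in> carrier G"
  shows "x \<oplus> \<ominus> y \<oplus> \<ominus> z = \<zero> \<longleftrightarrow> x = z \<oplus> y"
proof
  assume "x \<oplus> \<ominus> y \<oplus> \<ominus> z = \<zero>"
  then have "x \<oplus> \<ominus> (z \<oplus> y) = \<zero>" using assms by (simp add: minus_add a_ac)
  then show "x = z \<oplus> y" using assms by (metis a_closed minus_equality minus_minus a_inv_closed)
next
  assume "x = z \<oplus> y"
  then have "x \<oplus> \<ominus> y \<oplus> \<ominus> z = (z \<oplus> \<ominus> z) \<oplus> (y \<oplus> \<ominus> y)" using assms by (simp add: a_ac)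
  then show "x \<oplus> \<ominus> y \<oplus> \<ominus> z = \<zero>" using assms by (simp add: r_neg)
qed

locale poisson_structure_on_differentials = poisson_differentials R A P
  for R :: "('r, 'k) ring_scheme" (structure) and A :: "('r, 'a, 'm) module_scheme" (structure)
    and P :: "'a \<Rightarrow> 'a \<Rightarrow> 'a" +
  fixes form :: "('a \<Rightarrow> 'a) set \<Rightarrow> ('a \<Rightarrow> 'a) set \<Rightarrow> 'a"
    and br :: "('a \<Rightarrow> 'a) set \<Rightarrow> ('a \<Rightarrow> 'a) set \<Rightarrow> ('a \<Rightarrow> 'a) set"
  assumes form: "kaehler_poisson_form R A P form" and br: "kaehler_bracket R A P br"
begin

abbreviation anchor where "anchor \<equiv> sharp R A form"

lemmas br_closed [simp] = kaehler_bracketD(2)[OF br]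
lemmas br_add_left = kaehler_bracketD(3)[OF br]
lemmas br_add_right = kaehler_bracketD(4)[OF br]
lemmas br_gen = kaehler_bracketD(7)[OF br]

lemma anchor_eq: "v \<in> carrier A \<Longrightarrow> anchor x v = form x (d v)"
  by (simp add: sharp_def der_of_hom_def)

lemma anchor_closed [simp]: "\<lbrakk>x \<in> carrier D; v \<in> carrier A\<rbrakk> \<Longrightarrow> anchor x v \<in> carrier A"
  by (simp add: anchor_eq kaehler_poisson_formD[OF form])

lemma anchor_add:
  "\<lbrakk>x \<in> carrier D; y \<in> carrier D; v \<in> carrier A\<rbrakk> \<Longrightarrow> anchor (x \<oplus>\<^bsub>D\<^esub> y) v = anchor x v \<oplus>\<^bsub>A\<^esub> anchor y v"
  by (simp add: anchor_eq kaehler_poisson_formD[OF form])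

lemma anchor_smult:
  "\<lbrakk>a \<in> carrier A; x \<in> carrier D; v \<in> carrier A\<rbrakk> \<Longrightarrow> anchor (a \<odot>\<^bsub>D\<^esub> x) v = a \<otimes>\<^bsub>A\<^esub> anchor x v"
  by (simp add: anchor_eq kaehler_poisson_formD[OF form])

lemma anchor_d: "\<lbrakk>u \<in> carrier A; v \<in> carrier A\<rbrakk> \<Longrightarrow> anchor (d u) v = P u v"
  using kaehler_poisson_formD(7)[OF form, of "\<one>\<^bsub>A\<^esub>" u "\<one>\<^bsub>A\<^esub>" v] by (simp add: anchor_eq)

lemma anchor_derivation:
  assumes x: "x \<in> carrier D"
  shows "anchor x \<in> derivations R A"
proof (rule derivationsI)
  show "anchor x \<in> extensional (carrier A)" by (simp add: sharp_def der_of_hom_def)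
  fix r v assume "r \<in> carrier R" "v \<in> carrier A"
  then show "anchor x (r \<odot>\<^bsub>A\<^esub> v) = r \<odot>\<^bsub>A\<^esub> anchor x v"
    using x by (simp add: anchor_eq d_smult kaehler_poisson_formD[OF form] scalar_mult)
qed (use x in \<open>simp_all add: anchor_eq d_add d_mult kaehler_poisson_formD[OF form] m_comm a_comm\<close>)

lemmas anchor_derivationD = derivationD[OF anchor_derivation]

lemma anchor_gen:
  assumes "a \<in> carrier A" and "u \<in> carrier A"
  shows "anchor (a \<odot>\<^bsub>D\<^esub> d u) = (\<lambda>v\<in>carrier A. a \<otimes>\<^bsub>A\<^esub> P u v)"
  using assms
  by (intro derivation_eqI anchor_derivation hamiltonian_derivation) (simp_all add: anchor_smult anchor_d)

lemma br_gen_antisym: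
  assumes "a \<in> carrier A" and "u \<in> carrier A" and "b \<in> carrier A" and "v \<in> carrier A"
  shows "br (a \<odot>\<^bsub>D\<^esub> d u) (b \<odot>\<^bsub>D\<^esub> d v) = \<ominus>\<^bsub>D\<^esub> br (b \<odot>\<^bsub>D\<^esub> d v) (a \<odot>\<^bsub>D\<^esub> d u)"
  using bracket_formula_antisym[OF assms] assms by (simp only: br_gen)

lemma br_antisym:
  assumes "x \<in> carrier D" and "y \<in> carrier D"
  shows "br x y = \<ominus>\<^bsub>D\<^esub> br y x"
  by (rule biadditive_antisym[OF D.abelian_group_axioms kaehler_bracket_biadditive[OF br]
        br_gen_antisym assms])

lemma br_self:
  assumes x: "x \<in> carrier D"
  shows "br x x = \<zero>\<^bsub>D\<^esub>"
proof (rule biadditive_alternating[OF D.abelian_group_axioms kaehler_bracket_biadditive[OF br]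
        br_gen_antisym _ x])
  fix a u assume a: "a \<in> carrier A" and u: "u \<in> carrier A"
  have "d \<zero>\<^bsub>A\<^esub> = \<zero>\<^bsub>D\<^esub>" using d_add[of "\<zero>\<^bsub>A\<^esub>" "\<zero>\<^bsub>A\<^esub>"] by simp
  then show "br (a \<odot>\<^bsub>D\<^esub> d u) (a \<odot>\<^bsub>D\<^esub> d u) = \<zero>\<^bsub>D\<^esub>"
    using a u P_antisym[OF a u]
    by (simp add: br_gen poisson.lie.bracket_self r_minus D.smult_l_minus D.M.r_neg)
qed

text \<open>
  The Leibniz rule is an equality of maps biadditive in \<open>(x, y)\<close>, although for fixed \<open>c\<close> neither side
  is \<open>A\<close>-linear. On generators it reduces to \<open>{u, c b} = b {u, c} + c {u, b}\<close>.
\<close>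

lemma br_smult:
  assumes x: "x \<in> carrier D" and c: "c \<in> carrier A" and y: "y \<in> carrier D"
  shows "br x (c \<odot>\<^bsub>D\<^esub> y) = c \<odot>\<^bsub>D\<^esub> br x y \<oplus>\<^bsub>D\<^esub> anchor x c \<odot>\<^bsub>D\<^esub> y"
proof (rule biadditive_eqI[where M = D, OF _ _ _ x y])
  show "biadditive D (\<lambda>x y. br x (c \<odot>\<^bsub>D\<^esub> y))"
    using c by (auto simp: biadditive_def br_add_left br_add_right D.smult_r_distr)
  show "biadditive D (\<lambda>x y. c \<odot>\<^bsub>D\<^esub> br x y \<oplus>\<^bsub>D\<^esub> anchor x c \<odot>\<^bsub>D\<^esub> y)"
    using c by (auto simp: biadditive_def br_add_left br_add_right anchor_add D.smult_r_distr
        D.smult_l_distr D.M.a_ac)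
next
  fix a u b v assume au: "a \<in> carrier A" "u \<in> carrier A" and bv: "b \<in> carrier A" "v \<in> carrier A"
  have "br (a \<odot>\<^bsub>D\<^esub> d u) (c \<odot>\<^bsub>D\<^esub> (b \<odot>\<^bsub>D\<^esub> d v)) = br (a \<odot>\<^bsub>D\<^esub> d u) ((c \<otimes>\<^bsub>A\<^esub> b) \<odot>\<^bsub>D\<^esub> d v)"
    using c bv by (simp add: D.smult_assoc1)
  also have "\<dots> = c \<odot>\<^bsub>D\<^esub> br (a \<odot>\<^bsub>D\<^esub> d u) (b \<odot>\<^bsub>D\<^esub> d v) \<oplus>\<^bsub>D\<^esub>
      anchor (a \<odot>\<^bsub>D\<^esub> d u) c \<odot>\<^bsub>D\<^esub> (b \<odot>\<^bsub>D\<^esub> d v)"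
    using au bv c by (simp add: br_gen anchor_gen P_mult_right D.smult_r_distr D.smult_l_distr
        r_distr D.M.a_ac m_ac flip: D.smult_assoc1)
  finally show "br (a \<odot>\<^bsub>D\<^esub> d u) (c \<odot>\<^bsub>D\<^esub> (b \<odot>\<^bsub>D\<^esub> d v)) = \<dots>" .
qed

text \<open>
  The Jacobi identity read as: the assignment of Hamiltonian derivations is a morphism of Lie algebras.
\<close>

lemma P_adjoint:
  assumes u: "u \<in> carrier A" and v: "v \<in> carrier A" and w: "w \<in> carrier A"
  shows "P (P u v) w = P u (P v w) \<ominus>\<^bsub>A\<^esub> P v (P u w)"
proof -
  have "P u (P v w) \<oplus>\<^bsub>A\<^esub> P v (P w u) = \<ominus>\<^bsub>A\<^esub> P w (P u v)"
    using poisson.lie.jacobi[OF u v w] u v w minus_equality[of "P u (P v w) \<oplus>\<^bsub>A\<^esub> P v (P w u)" "P w (P u v)"]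
    by simp
  moreover have "P v (P w u) = \<ominus>\<^bsub>A\<^esub> P v (P u w)"
  proof -
    interpret v: abelian_group_hom A A "P v"
      by (rule abelian_group_hom_of_additive) (simp_all add: v abelian_group_axioms P_add_right)
    have "P v (\<ominus>\<^bsub>A\<^esub> P u w) = \<ominus>\<^bsub>A\<^esub> P v (P u w)" using u w by simp
    then show ?thesis using P_antisym[OF w u] by simp
  qed
  ultimately show ?thesis using P_antisym[of "P u v" w] u v w by (simp add: minus_eq)
qed

text \<open>
  Both sides are biadditive in \<open>(x, y)\<close>, so that it suffices to compare them on \<open>a du\<close> and \<open>b dv\<close>.
\<close>

lemma anchor_br:
  assumes x: "x \<in> carrier D" and y: "y \<in> carrier D" and w: "w \<in> carrier A"
  shows "anchor (br x y) w = anchor x (anchor y w) \<ominus>\<^bsub>A\<^esub> anchor y (anchor x w)"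
proof (rule biadditive_eqI[where M = A, OF _ _ _ x y])
  show "biadditive A (\<lambda>x y. anchor (br x y) w)"
    using w by (auto simp: biadditive_def br_add_left br_add_right anchor_add)
  show "biadditive A (\<lambda>x y. anchor x (anchor y w) \<ominus>\<^bsub>A\<^esub> anchor y (anchor x w))"
    using w by (auto simp: biadditive_def anchor_add anchor_derivationD minus_eq minus_add a_ac)
next
  fix a u b v assume au: "a \<in> carrier A" "u \<in> carrier A" and bv: "b \<in> carrier A" "v \<in> carrier A"
  show "anchor (br (a \<odot>\<^bsub>D\<^esub> d u) (b \<odot>\<^bsub>D\<^esub> d v)) w =
      anchor (a \<odot>\<^bsub>D\<^esub> d u) (anchor (b \<odot>\<^bsub>D\<^esub> d v) w) \<ominus>\<^bsub>A\<^esub> anchor (b \<odot>\<^bsub>D\<^esub> d v) (anchor (a \<odot>\<^bsub>D\<^esub> d u) w)"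
    using au bv w P_antisym[of v a]
    by (simp add: br_gen anchor_add anchor_smult anchor_d P_mult_right P_adjoint minus_eq minus_add
        r_distr l_minus r_minus a_ac m_ac)
qed

lemma anchor_anchor:
  assumes x: "x \<in> carrier D" and y: "y \<in> carrier D" and w: "w \<in> carrier A"
  shows "anchor x (anchor y w) = anchor (br x y) w \<oplus>\<^bsub>A\<^esub> anchor y (anchor x w)"
  using x y w by (simp add: anchor_br minus_eq a_assoc l_neg)

text \<open>
  The identity is named at a single triple because the proof moves from special triples to general ones.
\<close>

definition jacobi_at where "jacobi_at x y z \<longleftrightarrow>
  br x (br y z) \<oplus>\<^bsub>D\<^esub> br y (br z x) \<oplus>\<^bsub>D\<^esub> br z (br x y) = \<zero>\<^bsub>D\<^esub>"

lemma jacobi_at_rotate: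
  "\<lbrakk>x \<in> carrier D; y \<in> carrier D; z \<in> carrier D\<rbrakk> \<Longrightarrow> jacobi_at x y z \<longleftrightarrow> jacobi_at y z x"
  by (simp add: jacobi_at_def D.M.a_ac)

lemma br_minus_right:
  assumes "x \<in> carrier D" and "y \<in> carrier D"
  shows "br x (\<ominus>\<^bsub>D\<^esub> y) = \<ominus>\<^bsub>D\<^esub> br x y"
proof -
  interpret x: abelian_group_hom D D "br x"
    by (rule abelian_group_hom_of_additive)
      (use assms in \<open>simp_all add: D.abelian_group_axioms br_add_right\<close>)
  show ?thesis using assms by simp
qed

text \<open>
  In this form, which has no signs, the identity says that \<open>[x, -]\<close> is a derivation of the bracket.
\<close>

lemma jacobi_at_iff_leibniz:
  assumes x: "x \<in> carrier D" and y: "y \<in> carrier D" and z: "z \<in> carrier D"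
  shows "jacobi_at x y z \<longleftrightarrow> br x (br y z) = br (br x y) z \<oplus>\<^bsub>D\<^esub> br y (br x z)"
proof -
  have "br y (br z x) = \<ominus>\<^bsub>D\<^esub> br y (br x z)"
    using x y z by (simp only: br_antisym[of z x] br_minus_right br_closed)
  moreover have "br z (br x y) = \<ominus>\<^bsub>D\<^esub> br (br x y) z"
    using x y z by (intro br_antisym) simp_all
  ultimately show ?thesis
    unfolding jacobi_at_def using x y z by (simp add: D.M.sum_minus_minus_zero_iff)
qed

text \<open>
  Replacing \<open>z\<close> by \<open>a z\<close> multiplies both sides of the Leibniz form by \<open>a\<close>, up to the terms
  \<open>\<pi>\<^sup>\<sharp>(x)(a) [y, z] + \<pi>\<^sup>\<sharp>(y)(a) [x, z]\<close>, which occur on both sides, and second-order terms, which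
  match because the anchor preserves brackets (\<open>anchor_anchor\<close>). So \<open>z\<close> may be taken exact.
\<close>

lemma jacobi_at_generated:
  assumes x: "x \<in> carrier D" and y: "y \<in> carrier D" and z: "z \<in> carrier D"
    and gen: "\<And>w. w \<in> carrier A \<Longrightarrow> jacobi_at x y (d w)"
  shows "jacobi_at x y z"
  using z
proof (induction rule: kaehler_induct)
  case (gen a w)
  have *: "br x (br y (d w)) = br (br x y) (d w) \<oplus>\<^bsub>D\<^esub> br y (br x (d w))"
    using assms(4)[of w] gen x y by (simp add: jacobi_at_iff_leibniz)
  show ?case
    using gen x y by (simp add: jacobi_at_iff_leibniz br_smult br_add_right * anchor_anchor[of x y]
        D.smult_r_distr D.smult_l_distr D.M.a_ac)
next
  case (add z z')
  then show ?case
    using x y by (simp add: jacobi_at_iff_leibniz br_add_right D.M.a_ac)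
qed

lemma br_d_d: "\<lbrakk>u \<in> carrier A; v \<in> carrier A\<rbrakk> \<Longrightarrow> br (d u) (d v) = d (P u v)"
proof -
  assume u: "u \<in> carrier A" and v: "v \<in> carrier A"
  have "P u \<one>\<^bsub>A\<^esub> = \<zero>\<^bsub>A\<^esub>"
    using derivation_one[OF anchor_derivation[of "d u"]] u by (simp add: anchor_d)
  moreover have "P \<one>\<^bsub>A\<^esub> v = \<zero>\<^bsub>A\<^esub>"
    using derivation_one[OF anchor_derivation[of "d v"]] v P_antisym[of "\<one>\<^bsub>A\<^esub>" v]
    by (simp add: anchor_d)
  ultimately show ?thesis
    using br_gen[of "\<one>\<^bsub>A\<^esub>" u "\<one>\<^bsub>A\<^esub>" v] u v by simp
qed

lemma jacobi_at_d:
  assumes "u \<in> carrier A" and "v \<in> carrier A" and "w \<in> carrier A"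
  shows "jacobi_at (d u) (d v) (d w)"
proof -
  have "d \<zero>\<^bsub>A\<^esub> = \<zero>\<^bsub>D\<^esub>" using d_add[of "\<zero>\<^bsub>A\<^esub>" "\<zero>\<^bsub>A\<^esub>"] by simp
  then show ?thesis
    unfolding jacobi_at_def using assms poisson.lie.jacobi[OF assms]
    by (simp add: br_d_d flip: d_add)
qed

text \<open>
  Starting from three exact differentials, \<open>jacobi_at_generated\<close> frees the last argument and a rotation
  brings the next exact one into last place; three rounds free all arguments.
\<close>

lemma br_jacobi:
  assumes x: "x \<in> carrier D" and y: "y \<in> carrier D" and z: "z \<in> carrier D"
  shows "jacobi_at x y z"
proof -
  have 1: "jacobi_at (d u) (d v) z'" if "u \<in> carrier A" "v \<in> carrier A" "z' \<in> carrier D" for u v z'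
    using that by (intro jacobi_at_generated[of "d u" "d v" z'] jacobi_at_d) auto
  have 2: "jacobi_at z' (d u) y'" if "u \<in> carrier A" "z' \<in> carrier D" "y' \<in> carrier D" for u z' y'
  proof (rule jacobi_at_generated)
    fix w assume "w \<in> carrier A"
    then show "jacobi_at z' (d u) (d w)"
      using that 1[of u w z'] jacobi_at_rotate[of z' "d u" "d w"] by simp
  qed (use that in simp_all)
  have 3: "jacobi_at x y (d w)" if "w \<in> carrier A" for w
    using that x y 2[of w y x] jacobi_at_rotate[of x y "d w"] jacobi_at_rotate[of y "d w" x] by simp
  show ?thesis by (rule jacobi_at_generated[OF x y z 3])
qed

lemma kaehler_ra_lie_algebra: "ra_lie_algebra R A D br anchor"
proof (intro ra_lie_algebra.intro ra_lie_algebra_axioms.intro lie_algebra_hom.intro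
    lie_algebra_hom_axioms.intro algebra_axioms D.module_axioms Der_lie_algebra)
  show "lie_algebra R (restrict_scalars R A D) br"
    by (intro lie_algebra.intro lie_algebra_axioms.intro restrict_scalars_module D.module_axioms)
      (use br_jacobi in \<open>simp_all add: br_add_left br_add_right br_self kaehler_bracketD(5,6)[OF br]
        jacobi_at_def\<close>)
  show "anchor \<in> linear_maps R (restrict_scalars R A D) (restrict_scalars R A (Der R A))"
    by (auto simp: linear_maps_def Der_simps anchor_derivation anchor_add anchor_smult
        derivation_add derivation_smult intro!: derivation_eqI)
next
  fix x y assume "x \<in> carrier (restrict_scalars R A D)" "y \<in> carrier (restrict_scalars R A D)"
  then show "anchor (br x y) = commutator A (anchor x) (anchor y)"
    by (intro derivation_eqI commutator_derivation anchor_derivation)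
      (simp_all add: commutator_def anchor_br)
qed (simp_all add: anchor_smult br_smult)

lemma anchor_ra_lie_algebra_hom:
  "ra_lie_algebra_hom R A D br anchor (Der R A) (commutator A) id anchor"
proof (intro ra_lie_algebra_hom.intro ra_lie_algebra_hom_axioms.intro kaehler_ra_lie_algebra
    Der_ra_lie_algebra)
  show "anchor \<in> linear_maps A D (Der R A)"
    by (auto simp: linear_maps_def Der_simps anchor_derivation anchor_add anchor_smult
        derivation_add derivation_smult intro!: derivation_eqI)
  show "lie_algebra_hom R (restrict_scalars R A D) br (restrict_scalars R A (Der R A)) (commutator A) anchor"
    using kaehler_ra_lie_algebra by (rule ra_lie_algebra.axioms)
qed simp

end

theorem theorem3p8:
  fixes R :: "('r, 'k) ring_scheme" and A :: "('r, 'a, 'm) module_scheme"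
    and P :: "'a \<Rightarrow> 'a \<Rightarrow> 'a"
  assumes "poisson_algebra R A P"
  shows "(\<exists>!form. kaehler_poisson_form R A P form) \<and>
    (\<exists>!br. kaehler_bracket R A P br) \<and>
    (\<forall>form br. kaehler_poisson_form R A P form \<longrightarrow> kaehler_bracket R A P br \<longrightarrow>
      (\<forall>a\<in>carrier A. \<forall>u\<in>carrier A.
        sharp R A form (a \<odot>\<^bsub>kaehler R A\<^esub> kaehler_d R A u) =
          (\<lambda>v\<in>carrier A. a \<otimes>\<^bsub>A\<^esub> P u v)) \<and>
      ra_lie_algebra R A (kaehler R A) br (sharp R A form) \<and>
      ra_lie_algebra_hom R A
        (kaehler R A) br (sharp R A form)
        (Der R A) (commutator A) id
        (sharp R A form))"
proof (intro conjI allI impI)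
  interpret P: poisson_algebra R A P by (rule assms)
  interpret poisson_differentials R A P
    by (intro poisson_differentials.intro kaehler_differentials.intro P.alg.algebra_axioms assms)
  show "\<exists>!form. kaehler_poisson_form R A P form"
    using kaehler_poisson_form_exists kaehler_poisson_form_unique by blast
  show "\<exists>!br. kaehler_bracket R A P br"
    using kaehler_bracket_exists kaehler_bracket_unique by blast
  fix form br assume form: "kaehler_poisson_form R A P form" and br: "kaehler_bracket R A P br"
  interpret poisson_structure_on_differentials R A P form br
    by unfold_locales (rule form, rule br)
  show "\<forall>a\<in>carrier A. \<forall>u\<in>carrier A. sharp R A form (a \<odot>\<^bsub>kaehler R A\<^esub> kaehler_d R A u) =
      (\<lambda>v\<in>carrier A. a \<otimes>\<^bsub>A\<^esub> P u v)"
    using anchor_gen by blast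
  show "ra_lie_algebra R A (kaehler R A) br (sharp R A form)"
    by (rule kaehler_ra_lie_algebra)
  show "ra_lie_algebra_hom R A (kaehler R A) br (sharp R A form) (Der R A) (commutator A) id
      (sharp R A form)"
    by (rule anchor_ra_lie_algebra_hom)
qed

end
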